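(* Suppose that $f(z)=h(z)+\overline{g(z)}=\sum_{n=1}^{\infty}a_n z^n+\overline{\sum_{n=2}^{\infty}b_n z^n}$ is a sense-preserving harmonic mapping in $\mathbb{D}$ and $h\prec\varphi$, where $\varphi$ is analytic and univalent in $\mathbb{D}$. Then $$\sum_{n=1}^{\infty}|a_n|r^n+\sum_{n=2}^{\infty}|b_n|r^n\leq \operatorname{dist}(0,\partial\varphi(\mathbb{D}))$$ for $|z|=r\leq r_s$, where $r_s$ is the positive real root of the equation $$\frac{r}{(1-r)^2}+\frac{r^2}{(1-r^2)^2}\sqrt{\left(\frac{r^6+11 r^4+11 r^2+1}{1-r^2}\right)\left(\frac{\pi^2}{6}-1\right)}=\frac{1}{4}$$ in the interval $(0,1)$. Moreover, the number $r_s$ cannot be replaced by a number greater than $R=0.161353\cdots$, where $R$ is the positive root (in $(0,1)$) of the equation $$\frac{2R^2}{(1-R)^2}-\log (1-R)=\frac{1}{4};$$ that is, for every $\rho\in(R,1)$ there exist $f$ and $\varphi$ satisfying the hypotheses for which the inequality fails for some $r\le\rho$.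
   Context: $\mathbb{D}=\{z\in\mathbb{C}:|z|<1\}$. A harmonic mapping $f$ in $\mathbb{D}$ is a complex-valued function whose real and imaginary parts are harmonic; it is written $f=h+\overline{g}$ with $h,g$ analytic in $\mathbb{D}$ and $g(0)=0$, with power series coefficients $a_n$ of $h$ and $b_n$ of $g$ (here $h(0)=0$ and $b_1=0$). A locally univalent harmonic mapping $f=h+\overline{g}$ is sense-preserving if $|h'(z)|^2-|g'(z)|^2>0$ in $\mathbb{D}$ (equivalently, the dilatation $\omega=g'/h'$ is analytic and maps $\mathbb{D}$ into itself). For analytic $h,\varphi$ in $\mathbb{D}$ with $h(0)=\varphi(0)$, $h\prec\varphi$ ($h$ is subordinate to $\varphi$) means $h(z)=\varphi(w(z))$ for some analytic $w$ on $\mathbb{D}$ with $|w(z)|\le|z|$; in particular here $\varphi(0)=h(0)=0$. $\operatorname{dist}(0,\partial\varphi(\mathbb{D}))$ is the Euclidean distance from $0=\varphi(0)$ to the boundary of $\varphi(\mathbb{D})$. *)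

theory Defs
  imports "HOL-Complex_Analysis.Complex_Analysis"
begin

abbreviation unit_disc :: "complex set" (\<open>\<D>\<close>) where
  "\<D> \<equiv> ball 0 1"

(* u is twice continuously differentiable and u_xx + u_yy = 0; here x = Re z, y = Im z, and
   u1, u2, u11, u12, u21, u22 are the partial derivatives of u of orders one and two. *)
definition harmonic_on :: "(complex \<Rightarrow> real) \<Rightarrow> complex set \<Rightarrow> bool" where
  "harmonic_on u S \<longleftrightarrow> open S \<and>
    (\<exists>u1 u2 u11 u12 u21 u22.
       (\<forall>z\<in>S. (u has_derivative (\<lambda>v. u1 z * Re v + u2 z * Im v)) (at z) \<and>
              (u1 has_derivative (\<lambda>v. u11 z * Re v + u12 z * Im v)) (at z) \<and>
              (u2 has_derivative (\<lambda>v. u21 z * Re v + u22 z * Im v)) (at z) \<and>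
              u11 z + u22 z = 0) \<and>
       continuous_on S u11 \<and> continuous_on S u12 \<and> continuous_on S u21 \<and> continuous_on S u22)"

definition harmonic_mapping_on :: "(complex \<Rightarrow> complex) \<Rightarrow> complex set \<Rightarrow> bool" where
  "harmonic_mapping_on f S \<longleftrightarrow> harmonic_on (\<lambda>z. Re (f z)) S \<and> harmonic_on (\<lambda>z. Im (f z)) S"

definition locally_univalent_on :: "(complex \<Rightarrow> complex) \<Rightarrow> complex set \<Rightarrow> bool" where
  "locally_univalent_on f S \<longleftrightarrow> (\<forall>z\<in>S. \<exists>U. open U \<and> z \<in> U \<and> U \<subseteq> S \<and> inj_on f U)"

(* The decomposition f = h + cnj g is unique because of the normalisation g 0 = 0. *)
definition sense_preserving_harmonic ::
    "(complex \<Rightarrow> complex) \<Rightarrow> (complex \<Rightarrow> complex) \<Rightarrow> (complex \<Rightarrow> complex) \<Rightarrow> bool" where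
  "sense_preserving_harmonic f h g \<longleftrightarrow>
     harmonic_mapping_on f \<D> \<and> locally_univalent_on f \<D> \<and>
     h holomorphic_on \<D> \<and> g holomorphic_on \<D> \<and> g 0 = 0 \<and>
     (\<forall>z\<in>\<D>. f z = h z + cnj (g z)) \<and>
     (\<forall>z\<in>\<D>. (cmod (deriv h z))\<^sup>2 - (cmod (deriv g z))\<^sup>2 > 0)"

definition subordinate :: "(complex \<Rightarrow> complex) \<Rightarrow> (complex \<Rightarrow> complex) \<Rightarrow> bool" (infix \<open>\<prec>\<close> 50) where
  "h \<prec> \<phi> \<longleftrightarrow>
     h holomorphic_on \<D> \<and> \<phi> holomorphic_on \<D> \<and> h 0 = \<phi> 0 \<and>
     (\<exists>w. w holomorphic_on \<D> \<and> (\<forall>z\<in>\<D>. cmod (w z) \<le> cmod z \<and> h z = \<phi> (w z)))"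

(* The index shifts encode that the series of h starts at n = 1 and that of g at n = 2. *)
definition admissible ::
    "(complex \<Rightarrow> complex) \<Rightarrow> (complex \<Rightarrow> complex) \<Rightarrow> (complex \<Rightarrow> complex) \<Rightarrow>
     (nat \<Rightarrow> complex) \<Rightarrow> (nat \<Rightarrow> complex) \<Rightarrow> (complex \<Rightarrow> complex) \<Rightarrow> bool" where
  "admissible f h g a b \<phi> \<longleftrightarrow>
     sense_preserving_harmonic f h g \<and>
     (\<forall>z\<in>\<D>. (\<lambda>n. a (n + 1) * z ^ (n + 1)) sums h z) \<and>
     (\<forall>z\<in>\<D>. (\<lambda>n. b (n + 2) * z ^ (n + 2)) sums g z) \<and>
     h \<prec> \<phi> \<and> \<phi> holomorphic_on \<D> \<and> inj_on \<phi> \<D>"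

definition majorant :: "(nat \<Rightarrow> complex) \<Rightarrow> (nat \<Rightarrow> complex) \<Rightarrow> real \<Rightarrow> real" where
  "majorant a b r =
     (\<Sum>n. cmod (a (n + 1)) * r ^ (n + 1)) + (\<Sum>n. cmod (b (n + 2)) * r ^ (n + 2))"

definition rs_root :: "real \<Rightarrow> bool" where
  "rs_root r \<longleftrightarrow> 0 < r \<and> r < 1 \<and>
     r / (1 - r)\<^sup>2 + r\<^sup>2 / (1 - r\<^sup>2)\<^sup>2 *
       sqrt ((r ^ 6 + 11 * r ^ 4 + 11 * r\<^sup>2 + 1) / (1 - r\<^sup>2) * (pi\<^sup>2 / 6 - 1)) = 1 / 4"

definition R_root :: "real \<Rightarrow> bool" where
  "R_root R \<longleftrightarrow> 0 < R \<and> R < 1 \<and> 2 * R\<^sup>2 / (1 - R)\<^sup>2 - ln (1 - R) = 1 / 4"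

end

(* With phi(z) = c z s(z)^2 and d = dist(0, boundary of phi(D)), the area theorem for 1/(z s(z^2)) controls the
   coefficients t_n of 1/s: sum (2n-1)|t_n|^2 <= 1 over n >= 1. This gives |c| <= 4d (Koebe), nearly sharp bounds for
   the first coefficients s_k of s, and |s_k| <= C 2^k for the others. For h = phi o w, bounded multipliers and Rogosinski's
   argument yield |a_n| <= |c| (|s_0|^2 + ... + |s_(n-1)|^2). Since b_1 = 0, the dilatation is z Omega(z) with
   |Omega| <= 1, and Bohr's inequality for Omega shows that for r <= 1/3 the worst case for the b-sum is Omega = 1:
   sum |b_n| r^n <= sum |a_n| n/(n+1) r^(n+1). The bound for the b-sum behind the equation for r_s comes from
   Cauchy-Schwarz and is weaker; this slack makes up for using the coefficient bounds above in place of
   the theorem |a_n| <= n|c| of de Branges. For the sharpness part, h = phi is the Koebe function and g' = z h'. *)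
theory Submission
  imports Defs
begin

section \<open>Parseval's identity and bounded multipliers\<close>

text \<open>For the Koebe function all s_k equal 1, the sums |s_0|^2 + ... + |s_(n-1)|^2 equal n,
  and the majorant estimate becomes exactly the left-hand side of the equation for R. The whole loss
  made by weaker coefficient bounds must therefore fit between r_s = 0.15928... and R = 0.161353...:
  the first five sums need care, while exponential growth is harmless for the rest. The square root
  s enters because subordination controls sums of squares of coefficients (by Parseval) rather than
  single ones; a coefficient of h is then a convolution of two series controlled in this way. The
  same square root opens the way to the area theorem, since z s(z^2) is, up to a constant, an odd
  square root of phi(z^2) and inherits univalence. The proof of the area theorem avoids the area
  enclosed by a curve: the image of an annulus around the pole is compared with a disc containing
  it, and an affine map must first round off the inner circle to make this comparison sharp.\<close>

lemma eball_1: "eball 0 1 = ball 0 1"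
  by (metis eball_ereal one_ereal_def)

lemma fps_conv_radius_ge_1_disc:
  assumes "f has_fps_expansion F" "f holomorphic_on ball 0 1"
  shows "fps_conv_radius F \<ge> 1"
  using holomorphic_on_imp_fps_conv_radius_ge[OF assms(1), of 1] assms(2) by (simp add: eball_1)

lemma fps_expansion_sums_disc:
  fixes F :: "complex fps"
  assumes "f has_fps_expansion F" "f holomorphic_on ball 0 1" "norm z < 1"
  shows "(\<lambda>n. fps_nth F n * z ^ n) sums f z"
  by (rule has_fps_expansion_imp_sums_complex[OF assms(1), of 1])
    (use assms in \<open>auto simp: eball_1 simp flip: one_ereal_def\<close>)

lemma has_integral_cis_int:
  "((\<lambda>\<theta>. cis (of_int m * \<theta>)) has_integral (if m = 0 then 2 * of_real pi else 0)) {0..2*pi}"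
proof (cases "m = 0")
  case True
  have "((\<lambda>\<theta>. 1 :: complex) has_integral (2 * pi - 0) *\<^sub>R 1) {0..2*pi}"
    using has_integral_const_real[of "1::complex" 0 "2*pi"] by simp
  then show ?thesis using True by (simp add: scaleR_conv_of_real)
next
  case False
  have "((\<lambda>\<theta>. exp (\<i> * of_int m * of_real \<theta>)) has_integral
      exp (\<i> * of_int m * of_real (2*pi)) / (\<i> * of_int m) - exp (\<i> * of_int m * of_real 0) / (\<i> * of_int m)) {0..2*pi}"
    by (rule fundamental_theorem_of_calculus)
      (use False in \<open>auto intro!: has_vector_derivative_real_field derivative_eq_intros\<close>)
  moreover have "exp (\<i> * of_int m * of_real (2*pi)) = 1"
    using exp_integer_2pi[of "of_int m"] by (simp add: mult_ac)
  ultimately show ?thesis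
    using False by (simp add: cis_conv_exp mult_ac)
qed

lemma has_integral_norm_polynomial_circle:
  fixes c :: "nat \<Rightarrow> complex" and s :: real
  shows "((\<lambda>\<theta>. (cmod (\<Sum>k<n. c k * (s * cis \<theta>) ^ k))\<^sup>2) has_integral
     2 * pi * (\<Sum>k<n. (cmod (c k))\<^sup>2 * s ^ (2*k))) {0..2*pi}"
proof -
  have eq: "complex_of_real ((cmod (\<Sum>k<n. c k * (s * cis \<theta>) ^ k))\<^sup>2) =
      (\<Sum>j<n. \<Sum>k<n. c j * cnj (c k) * s ^ (j + k) * cis (of_int (int j - int k) * \<theta>))" for \<theta>
  proof -
    have cis: "cis (of_int (int j - int k) * \<theta>) = cis \<theta> ^ j * cnj (cis \<theta> ^ k)" for j k
      by (simp add: Complex.DeMoivre cis_cnj cis_mult algebra_simps)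
    show ?thesis
      unfolding complex_norm_square cis
      by (simp add: sum_product cnj_sum power_mult_distrib power_add mult_ac)
  qed
  have "((\<lambda>\<theta>. \<Sum>j<n. \<Sum>k<n. c j * cnj (c k) * s ^ (j + k) * cis (of_int (int j - int k) * \<theta>)) has_integral
      (\<Sum>j<n. \<Sum>k<n. c j * cnj (c k) * s ^ (j + k) * (if int j - int k = 0 then 2 * of_real pi else 0))) {0..2*pi}"
    by (intro has_integral_sum has_integral_mult_right has_integral_cis_int) auto
  also have "(\<Sum>j<n. \<Sum>k<n. c j * cnj (c k) * s ^ (j + k) * (if int j - int k = 0 then 2 * of_real pi else 0))
     = (\<Sum>j<n. c j * cnj (c j) * s ^ (j + j) * (2 * of_real pi))"
  proof (rule sum.cong[OF refl])
    fix j assume j: "j \<in> {..<n}"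
    have "(\<Sum>k<n. c j * cnj (c k) * s ^ (j + k) * (if int j - int k = 0 then 2 * of_real pi else 0))
      = (\<Sum>k<n. if k = j then c j * cnj (c k) * s ^ (j + k) * (2 * of_real pi) else 0)"
      by (rule sum.cong) auto
    also have "\<dots> = c j * cnj (c j) * s ^ (j + j) * (2 * of_real pi)"
      using j by (subst sum.delta) auto
    finally show "(\<Sum>k<n. c j * cnj (c k) * s ^ (j + k) * (if int j - int k = 0 then 2 * of_real pi else 0))
      = c j * cnj (c j) * s ^ (j + j) * (2 * of_real pi)" .
  qed
  also have "\<dots> = complex_of_real (2 * pi * (\<Sum>k<n. (cmod (c k))\<^sup>2 * s ^ (2*k)))"
  proof -
    have "c j * cnj (c j) * s ^ (j + j) * (2 * of_real pi) = of_real (2 * pi * ((cmod (c j))\<^sup>2 * s ^ (2*j)))" for j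
    proof -
      have "c j * cnj (c j) = of_real ((cmod (c j))\<^sup>2)" by (simp only: complex_norm_square)
      then show ?thesis by (simp add: mult_2[of j])
    qed
    then show ?thesis by (simp only: sum_distrib_left of_real_sum)
  qed
  finally have "((\<lambda>\<theta>. complex_of_real ((cmod (\<Sum>k<n. c k * (s * cis \<theta>) ^ k))\<^sup>2)) has_integral
      complex_of_real (2 * pi * (\<Sum>k<n. (cmod (c k))\<^sup>2 * s ^ (2*k)))) {0..2*pi}"
    by (simp only: eq)
  from has_integral_Re[OF this] show ?thesis by simp
qed

text \<open>The power series converges uniformly on the circle of radius s < 1, so the identity for
  polynomials passes to the limit.\<close>

lemma parseval_disc:
  fixes F :: "complex fps"
  assumes "f has_fps_expansion F" "f holomorphic_on ball 0 1" "0 \<le> s" "s < 1"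
  shows "(\<lambda>k. 2 * pi * ((cmod (fps_nth F k))\<^sup>2 * s ^ (2*k))) sums
      integral {0..2*pi} (\<lambda>\<theta>. (cmod (f (s * cis \<theta>)))\<^sup>2)"
proof -
  have "fps_conv_radius F \<ge> 1"
    by (rule fps_conv_radius_ge_1_disc[OF assms(1,2)])
  hence "ereal s < conv_radius (fps_nth F)"
    using assms(4) unfolding fps_conv_radius_def by (metis ereal_less(3) less_le_trans)
  from powser_uniform_limit[OF this, of 0]
  have "uniform_limit (cball 0 s) (\<lambda>n z. \<Sum>i<n. fps_nth F i * z ^ i) (\<lambda>z. suminf (\<lambda>i. fps_nth F i * z ^ i)) sequentially"
    by simp
  also have "?this \<longleftrightarrow> uniform_limit (cball 0 s) (\<lambda>n z. \<Sum>i<n. fps_nth F i * z ^ i) f sequentially"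
    by (intro uniform_limit_cong' refl)
       (use fps_expansion_sums_disc[OF assms(1,2)] assms in \<open>auto simp: sums_iff\<close>)
  finally have ul: "uniform_limit (cball 0 s) (\<lambda>n z. \<Sum>i<n. fps_nth F i * z ^ i) f sequentially" .
  have ul1: "uniform_limit {0..2*pi} (\<lambda>n \<theta>. \<Sum>i<n. fps_nth F i * (s * cis \<theta>) ^ i) (\<lambda>\<theta>. f (s * cis \<theta>)) sequentially"
    by (rule uniform_limit_compose'[OF ul]) (use assms in \<open>auto simp: norm_mult\<close>)
  have bdd: "bounded ((\<lambda>\<theta>. cmod (f (s * cis \<theta>))) ` {0..2*pi})"
  proof (intro compact_imp_bounded compact_continuous_image compact_Icc continuous_intros)
    show "continuous_on {0..2*pi} (\<lambda>x. f (s * cis x))"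
      by (rule continuous_on_compose2[OF holomorphic_on_imp_continuous_on[OF assms(2)]])
        (use assms in \<open>auto intro!: continuous_intros simp: norm_mult\<close>)
  qed
  have ul2: "uniform_limit {0..2*pi} (\<lambda>n \<theta>. (cmod (\<Sum>i<n. fps_nth F i * (s * cis \<theta>) ^ i))\<^sup>2)
      (\<lambda>\<theta>. (cmod (f (s * cis \<theta>)))\<^sup>2) sequentially"
    unfolding power2_eq_square
    by (intro uniform_lim_mult uniform_limit_norm ul1 bdd)
  from ul2 obtain I J where IJ:
    "\<And>n. ((\<lambda>\<theta>. (cmod (\<Sum>i<n. fps_nth F i * (s * cis \<theta>) ^ i))\<^sup>2) has_integral I n) {0..2*pi}"
    "((\<lambda>\<theta>. (cmod (f (s * cis \<theta>)))\<^sup>2) has_integral J) {0..2*pi}" "I \<longlonglongrightarrow> J"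
    by (rule uniform_limit_integral) (auto intro!: continuous_intros)
  have "I = (\<lambda>n. 2 * pi * (\<Sum>k<n. (cmod (fps_nth F k))\<^sup>2 * s ^ (2*k)))"
    using has_integral_unique[OF IJ(1) has_integral_norm_polynomial_circle] by blast
  with IJ(2,3) show ?thesis
    by (simp add: sums_def sum_distrib_left integral_unique)
qed

text \<open>The coefficients of \<open>V * P\<close> up to index n only see those of
  \<open>P\<close> up to n, so \<open>P\<close> may be cut to a polynomial \<open>Q\<close>; on
  circles |v q| <= |q|, and Parseval compares both sides. \<open>P\<close> is a purely formal
  series, so compositions can be inserted later without convergence questions.\<close>

lemma schur_multiplier_l2:
  fixes V P :: "complex fps"
  assumes v: "v has_fps_expansion V" "v holomorphic_on ball 0 1" "\<And>z. cmod z < 1 \<Longrightarrow> cmod (v z) \<le> 1"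
  shows "(\<Sum>k\<le>n. (cmod (fps_nth (V * P) k))\<^sup>2) \<le> (\<Sum>k\<le>n. (cmod (fps_nth P k))\<^sup>2)"
proof -
  define Q where "Q = (\<Sum>k<Suc n. fps_const (fps_nth P k) * fps_X ^ k)"
  define q where "q = (\<lambda>z. \<Sum>k<Suc n. fps_nth P k * z ^ k)"
  have q: "q has_fps_expansion Q"
    unfolding q_def Q_def
    by (intro has_fps_expansion_sum has_fps_expansion_cmult_left has_fps_expansion_fps_X_power)
  have hq: "q holomorphic_on ball 0 1"
    unfolding q_def by (intro holomorphic_intros)
  have nthQ: "fps_nth Q k = fps_nth P k" if "k \<le> n" for k
    using that unfolding Q_def by (simp add: fps_sum_nth if_distrib cong: if_cong del: sum.lessThan_Suc)
  have nthVQ: "fps_nth (V * Q) k = fps_nth (V * P) k" if "k \<le> n" for k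
    using that unfolding fps_mult_nth by (intro sum.cong refl) (auto simp: nthQ)
  have le: "(\<Sum>k\<le>n. (cmod (fps_nth (V * P) k))\<^sup>2 * s ^ (2*k)) \<le> (\<Sum>k\<le>n. (cmod (fps_nth P k))\<^sup>2)"
    if s: "0 \<le> s" "s < 1" for s :: real
  proof -
    have ball: "complex_of_real s * cis \<theta> \<in> ball 0 1" for \<theta>
      using s by (simp add: norm_mult)
    have cont: "(\<lambda>\<theta>. (cmod (g (s * cis \<theta>)))\<^sup>2) integrable_on {0..2*pi}" if "g holomorphic_on ball 0 1" for g
      by (intro integrable_continuous_interval continuous_intros
           continuous_on_compose2[OF holomorphic_on_imp_continuous_on[OF that]])
         (use ball in auto)
    have vq: "(\<lambda>z. v z * q z) has_fps_expansion V * Q" "(\<lambda>z. v z * q z) holomorphic_on ball 0 1"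
      by (intro has_fps_expansion_mult v q holomorphic_intros hq)+
    have "2 * pi * (\<Sum>k\<le>n. (cmod (fps_nth (V * P) k))\<^sup>2 * s ^ (2*k))
        = (\<Sum>k\<le>n. 2 * pi * ((cmod (fps_nth (V * Q) k))\<^sup>2 * s ^ (2*k)))"
      by (simp add: nthVQ sum_distrib_left)
    also have "\<dots> \<le> integral {0..2*pi} (\<lambda>\<theta>. (cmod (v (s * cis \<theta>) * q (s * cis \<theta>)))\<^sup>2)"
      unfolding sums_unique[OF parseval_disc[OF vq s]]
      by (intro sum_le_suminf sums_summable[OF parseval_disc[OF vq s]]) (use s in auto)
    also have "\<dots> \<le> integral {0..2*pi} (\<lambda>\<theta>. (cmod (q (s * cis \<theta>)))\<^sup>2)"
    proof (rule integral_le)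
      show "(cmod (v (s * cis \<theta>) * q (s * cis \<theta>)))\<^sup>2 \<le> (cmod (q (s * cis \<theta>)))\<^sup>2" for \<theta>
        unfolding norm_mult power_mult_distrib
        by (intro mult_left_le_one_le power_le_one v(3)) (use ball[of \<theta>] in auto)
    qed (rule cont[OF vq(2)], rule cont[OF hq])
    also have "\<dots> = 2 * pi * (\<Sum>k<Suc n. (cmod (fps_nth P k))\<^sup>2 * s ^ (2*k))"
      unfolding q_def by (intro integral_unique has_integral_norm_polynomial_circle)
    also have "\<dots> \<le> 2 * pi * (\<Sum>k\<le>n. (cmod (fps_nth P k))\<^sup>2)"
      unfolding lessThan_Suc_atMost
      by (intro mult_left_mono sum_mono mult_right_le_one_le) (use s in \<open>auto intro: power_le_one\<close>)
    finally show ?thesis by simp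
  qed
  \<comment> \<open>The weights s^(2k) disappear as s tends to 1; the sums are finite, so no
    interchange of limits is involved.\<close>
  have "((\<lambda>s::real. \<Sum>k\<le>n. (cmod (fps_nth (V * P) k))\<^sup>2 * s ^ (2*k)) \<longlongrightarrow>
      (\<Sum>k\<le>n. (cmod (fps_nth (V * P) k))\<^sup>2 * 1 ^ (2*k))) (at_left 1)"
    by (intro tendsto_intros)
  moreover have "\<forall>\<^sub>F s in at_left (1::real). (\<Sum>k\<le>n. (cmod (fps_nth (V * P) k))\<^sup>2 * s ^ (2*k)) \<le> (\<Sum>k\<le>n. (cmod (fps_nth P k))\<^sup>2)"
    by (rule eventually_mono[OF eventually_at_left_real[of 0 1]]) (use le in auto)
  ultimately show ?thesis
    by (intro tendsto_upperbound[where F = "at_left (1::real)"]) auto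
qed

text \<open>Testing \<open>schur_multiplier_l2\<close> on a two-term polynomial suffices. With a, b
  the coefficients of index 0 and j it yields |a|^2 + (|b| + |a|^2)^2 <= 1 + |a|^2, where |a|^2
  cancels.\<close>

lemma schur_coeff_bound:
  fixes V :: "complex fps"
  assumes v: "v has_fps_expansion V" "v holomorphic_on ball 0 1" "\<And>z. cmod z < 1 \<Longrightarrow> cmod (v z) \<le> 1"
  assumes "j > 0"
  shows "cmod (fps_nth V j) \<le> 1 - (cmod (fps_nth V 0))\<^sup>2"
proof -
  define a where "a = fps_nth V 0"
  define b where "b = fps_nth V j"
  define u where "u = (if a = 0 \<or> b = 0 then 1 else cnj a * b / (cmod a * cmod b))"
  \<comment> \<open>\<open>u\<close> aligns the phases, so that \<open>V\<close> times \<open>1 + |a| u z\<^sup>j\<close> has j-th coefficient of modulus \<open>|b| + |a|\<^sup>2\<close>\<close>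
  have u: "cmod u = 1" by (auto simp: u_def norm_mult norm_divide)
  have au: "cmod (b + a * (cmod a * u)) = cmod b + (cmod a)\<^sup>2"
  proof (cases "a = 0 \<or> b = 0")
    case True
    then show ?thesis using u by (auto simp: norm_mult power2_eq_square)
  next
    case False
    have "a * (cmod a * u) = (a * cnj a) * (b / cmod b)"
      using False by (simp add: u_def)
    also have "a * cnj a = of_real ((cmod a)\<^sup>2)"
      by (simp only: complex_norm_square)
    finally have "b + a * (cmod a * u) = b * of_real (1 + (cmod a)\<^sup>2 / cmod b)"
      by (simp add: algebra_simps)
    also have "cmod \<dots> = cmod b * (1 + (cmod a)\<^sup>2 / cmod b)"
      by (subst norm_mult, subst norm_of_real) (simp add: abs_of_nonneg add_nonneg_nonneg)
    also have "\<dots> = cmod b + (cmod a)\<^sup>2" using False by (simp add: field_simps)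
    finally show ?thesis .
  qed
  define P :: "complex fps" where "P = 1 + fps_const (cmod a * u) * fps_X ^ j"
  have nthP: "fps_nth P k = (if k = 0 then 1 else if k = j then cmod a * u else 0)" for k
    using \<open>j > 0\<close> by (simp add: P_def fps_X_power_nth)
  have VP: "V * P = V + fps_const (cmod a * u) * (fps_X ^ j * V)"
    by (simp only: P_def ring_distribs mult_ac mult_1_left mult_1_right)
  have nth: "fps_nth (V * P) 0 = a" "fps_nth (V * P) j = b + a * (cmod a * u)"
    using \<open>j > 0\<close> unfolding VP by (auto simp: a_def b_def fps_X_power_mult_nth)
  have "(cmod a)\<^sup>2 + (cmod b + (cmod a)\<^sup>2)\<^sup>2 = (\<Sum>k\<in>{0,j}. (cmod (fps_nth (V * P) k))\<^sup>2)"
    using \<open>j > 0\<close> nthP[of 0] by (simp add: nth au flip: a_def)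
  also have "\<dots> \<le> (\<Sum>k\<le>j. (cmod (fps_nth (V * P) k))\<^sup>2)"
    by (rule sum_mono2) auto
  also have "\<dots> \<le> (\<Sum>k\<le>j. (cmod (fps_nth P k))\<^sup>2)"
    by (rule schur_multiplier_l2[OF v])
  also have "\<dots> = (\<Sum>k\<in>{0,j}. (cmod (fps_nth P k))\<^sup>2)"
    by (rule sum.mono_neutral_right) (auto simp: nthP)
  also have "\<dots> = 1 + (cmod a)\<^sup>2"
    using \<open>j > 0\<close> u by (simp add: nthP norm_mult)
  finally have "(cmod b + (cmod a)\<^sup>2)\<^sup>2 \<le> 1\<^sup>2" by simp
  hence "cmod b + (cmod a)\<^sup>2 \<le> 1"
    by (rule power2_le_imp_le) auto
  thus ?thesis by (simp add: a_def b_def)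
qed

text \<open>With m = |V_0| all later coefficients are at most 1 - m^2, and the powers of 1/3 from
  exponent 1 on sum to at most 1/2. The radius 1/3 is thus what gives m + (1 - m^2)/2 = 1 - (1 -
  m)^2/2.\<close>

lemma bohr_inequality:
  fixes V :: "complex fps"
  assumes v: "v has_fps_expansion V" "v holomorphic_on ball 0 1" "\<And>z. cmod z < 1 \<Longrightarrow> cmod (v z) \<le> 1"
  assumes r: "0 \<le> r" "r \<le> 1/3"
  shows "(\<Sum>k\<le>n. cmod (fps_nth V k) * r ^ k) \<le> 1"
proof -
  define m where "m = cmod (fps_nth V 0)"
  have m: "0 \<le> m" "m \<le> 1"
  proof -
    have "cmod (v 0) \<le> 1" using v(3)[of 0] by simp
    thus "m \<le> 1" using has_fps_expansion_imp_0_eq_fps_nth_0[OF v(1)] by (simp add: m_def)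
  qed (simp add: m_def)
  have "(\<Sum>k\<le>n. cmod (fps_nth V k) * r ^ k) = m + (\<Sum>k=1..n. cmod (fps_nth V k) * r ^ k)"
    by (simp add: m_def atMost_atLeast0 sum.atLeast_Suc_atMost)
  also have "\<dots> \<le> m + (\<Sum>k=1..n. (1 - m\<^sup>2) * (1/3) ^ k)"
    unfolding m_def
    by (intro add_left_mono sum_mono mult_mono schur_coeff_bound[OF v] power_mono)
       (use r m in \<open>auto simp: m_def abs_square_le_1\<close>)
  also have "\<dots> = m + (1 - m\<^sup>2) * (\<Sum>k=1..n. (1/3) ^ k)"
    by (simp add: sum_distrib_left)
  also have "(\<Sum>k=1..n. (1/3::real) ^ k) = (1 - (1/3) ^ n) / 2"
  proof (induction n)
    case (Suc n)
    have "(1/3::real) ^ Suc n = (1/3) ^ n / 3" by simp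
    with Suc show ?case by (simp only: sum.cl_ivl_Suc) (simp add: diff_divide_distrib)
  qed simp
  also have "m + (1 - m\<^sup>2) * ((1 - (1/3) ^ n) / 2) \<le> m + (1 - m\<^sup>2) * (1 / 2)"
    using m by (intro add_left_mono mult_left_mono) (auto simp: abs_square_le_1)
  also have "\<dots> = 1 - (1 - m)\<^sup>2 / 2" by (simp add: power2_eq_square field_simps)
  also have "\<dots> \<le> 1" by simp
  finally show ?thesis .
qed

section \<open>Subordination: the Schwarz factor and Rogosinski's inequality\<close>

lemma schwarz_factor:
  fixes W :: "complex fps"
  assumes w: "w has_fps_expansion W" "w holomorphic_on ball 0 1" "\<And>z. cmod z < 1 \<Longrightarrow> cmod (w z) \<le> cmod z"
  obtains v V where "v has_fps_expansion V" "v holomorphic_on ball 0 1" "\<And>z. cmod z < 1 \<Longrightarrow> cmod (v z) \<le> 1"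
    "\<And>z. w z = z * v z" "W = fps_X * V"
proof -
  have w0: "w 0 = 0" using w(3)[of 0] by simp
  define v where "v = (\<lambda>z. if z = 0 then deriv w 0 else (w z - w 0) / (z - 0))"
  have hol: "v holomorphic_on ball 0 1"
    unfolding v_def by (rule pole_lemma[OF w(2)]) auto
  have eq: "w z = z * v z" for z by (simp add: v_def w0)
  have v1: "cmod (v z) \<le> 1" if "cmod z < 1" for z
  proof (cases "z = 0")
    case True
    have "cmod (deriv w 0) \<le> 1"
      by (rule Schwarz_Lemma(2)[OF w(2) w0 _ that]) (use w(3) in \<open>auto intro: le_less_trans\<close>)
    then show ?thesis using True by (simp add: v_def)
  next
    case False
    then show ?thesis using w(3)[OF that] by (simp add: v_def w0 norm_divide)
  qed
  have vf: "v has_fps_expansion fps_expansion v 0"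
    by (rule has_fps_expansion_fps_expansion[OF _ _ hol]) auto
  have "(\<lambda>z. z * v z) has_fps_expansion fps_X * fps_expansion v 0"
    by (intro has_fps_expansion_mult has_fps_expansion_fps_X vf)
  moreover have "(\<lambda>z. z * v z) = w" using eq by auto
  ultimately have "W = fps_X * fps_expansion v 0"
    using fps_expansion_unique_complex w(1) by metis
  with that vf hol v1 eq show ?thesis by blast
qed

text \<open>Write S = S_0 + X Q and W = X V. Then S o W = S_0 + X V (Q o W): the factor X lowers the
  index by one, \<open>schur_multiplier_l2\<close> removes V, and the induction hypothesis applies
  to the shifted series Q, hence \<open>arbitrary: S\<close>.\<close>

lemma rogosinski_l2:
  fixes W S :: "complex fps"
  assumes w: "w has_fps_expansion W" "w holomorphic_on ball 0 1" "\<And>z. cmod z < 1 \<Longrightarrow> cmod (w z) \<le> cmod z"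
  shows "(\<Sum>k\<le>n. (cmod (fps_nth (S oo W) k))\<^sup>2) \<le> (\<Sum>k\<le>n. (cmod (fps_nth S k))\<^sup>2)"
proof (induction n arbitrary: S)
  case 0
  show ?case by simp
next
  case (Suc n)
  obtain v V where v: "v has_fps_expansion V" "v holomorphic_on ball 0 1" "\<And>z. cmod z < 1 \<Longrightarrow> cmod (v z) \<le> 1"
    and W: "W = fps_X * V"
    using schwarz_factor[OF w] by metis
  have W0: "fps_nth W 0 = 0" by (simp add: W)
  define Q where "Q = fps_shift 1 S"
  have S: "S = fps_const (fps_nth S 0) + fps_X * Q"
    by (rule fps_ext) (auto simp: Q_def)
  have "S oo W = fps_const (fps_nth S 0) + W * (Q oo W)"
    by (subst S) (simp add: fps_compose_add_distrib fps_compose_mult_distrib[OF W0] fps_X_fps_compose_startby0 W0)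
  hence "S oo W = fps_const (fps_nth S 0) + fps_X * (V * (Q oo W))"
    by (simp add: W mult.assoc)
  hence nth: "fps_nth (S oo W) 0 = fps_nth S 0" "fps_nth (S oo W) (Suc k) = fps_nth (V * (Q oo W)) k" for k
    by simp_all
  have "(\<Sum>k\<le>Suc n. (cmod (fps_nth (S oo W) k))\<^sup>2)
      = (cmod (fps_nth S 0))\<^sup>2 + (\<Sum>k\<le>n. (cmod (fps_nth (V * (Q oo W)) k))\<^sup>2)"
    unfolding sum.atMost_Suc_shift nth ..
  also have "\<dots> \<le> (cmod (fps_nth S 0))\<^sup>2 + (\<Sum>k\<le>n. (cmod (fps_nth Q k))\<^sup>2)"
    by (intro add_left_mono order_trans[OF schur_multiplier_l2[OF v] Suc.IH])
  also have "\<dots> = (\<Sum>k\<le>Suc n. (cmod (fps_nth S k))\<^sup>2)"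
    unfolding sum.atMost_Suc_shift by (simp add: Q_def)
  finally show ?case .
qed

section \<open>The area theorem\<close>

lemma cbox_real2:
  "x \<in> cbox (u :: real^2) v \<longleftrightarrow> (x$1, x$2) \<in> cbox (u$1, u$2) (v$1, v$2)"
  by (auto simp: mem_box_cart forall_2)

text \<open>The Jacobian formula for the measure of an image is used on \<open>real^2\<close>, the
  iterated integral on pairs. The coordinate map preserves contents of boxes and carries the
  integral across.\<close>

lemma has_integral_real2:
  fixes F :: "real \<times> real \<Rightarrow> real"
  assumes "continuous_on (cbox (a, c) (b, d)) F"
  shows "((\<lambda>x::real^2. F (x$1, x$2)) has_integral
           integral {a..b} (\<lambda>s. integral {c..d} (\<lambda>t. F (s, t)))) (cbox (vector [a, c]) (vector [b, d]))"
proof -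
  define g :: "real^2 \<Rightarrow> real \<times> real" where "g = (\<lambda>x. (x$1, x$2))"
  define h :: "real \<times> real \<Rightarrow> real^2" where "h = (\<lambda>p. vector [fst p, snd p])"
  have hg: "h (g x) = x" and gh: "g (h p) = p" for x p
    by (auto simp: g_def h_def vec_eq_iff forall_2)
  have gi: "g ` cbox u v = cbox (u$1, u$2) (v$1, v$2)" for u v
  proof (intro set_eqI iffI)
    fix p assume "p \<in> cbox (u$1, u$2) (v$1, v$2)"
    hence "h p \<in> cbox u v" by (auto simp: cbox_real2 h_def)
    thus "p \<in> g ` cbox u v" using gh by (metis image_eqI)
  qed (auto simp: g_def cbox_real2)
  have hi: "h ` cbox p q = cbox (h p) (h q)" for p q
  proof -
    have "cbox p q = g ` cbox (h p) (h q)" by (simp add: gi h_def)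
    thus ?thesis by (simp add: image_image hg)
  qed
  have int: "(F has_integral integral (cbox (a, c) (b, d)) F) (cbox (a, c) (b, d))"
    by (intro integrable_integral integrable_continuous assms)
  have contg: "continuous (at x) g" for x
  proof -
    have "linear g" by (rule linearI) (auto simp: g_def)
    thus ?thesis by (simp add: linear_continuous_at linear_conv_bounded_linear)
  qed
  have gcb: "measure lborel (g ` cbox u v) = 1 * measure lborel (cbox u v)" for u v :: "real^2"
  proof -
    have "cbox u v \<noteq> {} \<longleftrightarrow> u$1 \<le> v$1 \<and> u$2 \<le> v$2"
      unfolding interval_ne_empty_cart by (simp add: forall_2)
    thus ?thesis
      unfolding gi content_Pair by (auto simp: content_cbox_if_cart UNIV_2 content_real_if)
  qed
  have "((\<lambda>x. F (g x)) has_integral (1 / 1) *\<^sub>R integral (cbox (a, c) (b, d)) F) (h ` cbox (a, c) (b, d))"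
    by (rule has_integral_twiddle[OF zero_less_one hg gh contg _ _ gcb int]) (use gi hi in blast)+
  also have "integral (cbox (a, c) (b, d)) F = integral {a..b} (\<lambda>s. integral {c..d} (\<lambda>t. F (s, t)))"
    using integral_prod_continuous[OF assms] by simp
  finally show ?thesis unfolding hi by (simp add: g_def h_def)
qed

text \<open>For |\<beta>| < 1 the real-linear map w - \<beta> cnj w is injective with determinant 1
  - |\<beta>|^2. After q it maps the rectangle injectively into the disc of radius K, whose area is
  the right-hand side. The freedom in \<beta> is what the area theorem exploits.\<close>

lemma area_bound_rectangle:
  fixes q :: "complex \<Rightarrow> complex" and a b c d K :: real
  defines "R \<equiv> cbox (Complex a c) (Complex b d)" and "R0 \<equiv> box (Complex a c) (Complex b d)"
  assumes q: "q holomorphic_on \<Omega>" "open \<Omega>" "R \<subseteq> \<Omega>" and inj: "inj_on q R0"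
    and \<beta>: "cmod \<beta> < 1"
    and K: "\<And>z. z \<in> R0 \<Longrightarrow> cmod (q z - \<beta> * cnj (q z)) \<le> K" "0 \<le> K"
  shows "(1 - (cmod \<beta>)\<^sup>2) * integral {a..b} (\<lambda>s. integral {c..d} (\<lambda>t. (cmod (deriv q (Complex s t)))\<^sup>2)) \<le> pi * K\<^sup>2"
proof -
  define U :: "real^2 \<Rightarrow> complex" where "U = (\<lambda>x. Complex (x$1) (x$2))"
  define T :: "complex \<Rightarrow> real^2" where "T = (\<lambda>w. vector [Re w, Im w])"
  define L where "L = (\<lambda>w. w - \<beta> * cnj w)"
  have U: "bounded_linear U"
    unfolding U_def by (intro linear_conv_bounded_linear[THEN iffD1] linearI) (auto simp: complex_eq_iff)
  have T: "bounded_linear T"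
    unfolding T_def by (intro linear_conv_bounded_linear[THEN iffD1] linearI) (auto simp: vec_eq_iff forall_2)
  have L: "bounded_linear L"
    unfolding L_def
    by (intro bounded_linear_sub bounded_linear_ident bounded_linear_compose[OF bounded_linear_mult_right bounded_linear_cnj])
  have normT: "norm (T w) = cmod w" for w
    by (simp add: T_def norm_vec_def L2_set_def UNIV_2 cmod_def)
  have Tinj: "T w = T w' \<Longrightarrow> w = w'" for w w'
    by (auto simp: T_def vec_eq_iff forall_2 complex_eq_iff)
  have Uinj: "U x = U x' \<Longrightarrow> x = x'" for x x'
    by (auto simp: U_def vec_eq_iff forall_2 complex_eq_iff)
  have Linj: "w = w'" if "L w = L w'" for w w'
  proof -
    have "w - w' = \<beta> * cnj (w - w')" using that by (simp add: L_def algebra_simps)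
    hence "cmod (w - w') = cmod \<beta> * cmod (w - w')" by (metis norm_mult complex_mod_cnj)
    thus ?thesis using \<beta> by auto
  qed
  define S :: "(real^2) set" where "S = box (vector [a, c]) (vector [b, d])"
  define S' :: "(real^2) set" where "S' = cbox (vector [a, c]) (vector [b, d])"
  have US: "U x \<in> R0" if "x \<in> S" for x
    using that by (auto simp: S_def R0_def U_def mem_box_cart forall_2 in_box_complex_iff)
  have US': "U x \<in> R" if "x \<in> S'" for x
    using that by (auto simp: S'_def R_def U_def mem_box_cart forall_2 in_cbox_complex_iff)
  have R0R: "R0 \<subseteq> R" unfolding R0_def R_def by (rule box_subset_cbox)
  define P where "P = (\<lambda>x. T (L (q (U x))))"
  define P' where "P' = (\<lambda>x h. T (L (deriv q (U x) * U h)))"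
  have der: "(P has_derivative P' x) (at x within S)" if "x \<in> S" for x
  proof -
    have "U x \<in> \<Omega>" using US[OF that] R0R q(3) by auto
    hence "(q has_field_derivative deriv q (U x)) (at (U x))"
      using q holomorphic_derivI by blast
    hence "(q has_derivative (*) (deriv q (U x))) (at (U x))"
      by (simp add: has_field_derivative_def)
    from diff_chain_at[OF bounded_linear_imp_has_derivative[OF U] this]
    have "((\<lambda>x. q (U x)) has_derivative (\<lambda>h. deriv q (U x) * U h)) (at x)"
      by (simp add: o_def)
    from bounded_linear.has_derivative[OF T bounded_linear.has_derivative[OF L this]]
    show ?thesis unfolding P_def P'_def by (rule has_derivative_at_withinI)
  qed
  have Pinj: "inj_on P S"
  proof (rule inj_onI)
    fix x y assume xy: "x \<in> S" "y \<in> S" "P x = P y"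
    hence "q (U x) = q (U y)" unfolding P_def by (blast dest: Tinj Linj)
    hence "U x = U y" using inj_onD[OF inj] US xy by blast
    thus "x = y" by (rule Uinj)
  qed
  define J where "J = (\<lambda>s t. (cmod (deriv q (Complex s t)))\<^sup>2)"
  have det: "\<bar>det (matrix (P' x))\<bar> = (1 - (cmod \<beta>)\<^sup>2) * J (x$1) (x$2)" for x
  proof -
    define A where "A = deriv q (U x)"
    have "U (axis 1 1) = 1" "U (axis 2 1) = \<i>"
      by (auto simp: U_def axis_def complex_eq_iff)
    hence "det (matrix (P' x)) = Re (L A) * Im (L (A * \<i>)) - Re (L (A * \<i>)) * Im (L A)"
      unfolding matrix_def P'_def by (simp add: det_2 T_def A_def)
    also have "\<dots> = (1 - (cmod \<beta>)\<^sup>2) * (cmod A)\<^sup>2"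
      unfolding cmod_power2 by (simp add: L_def algebra_simps power2_eq_square)
    finally show ?thesis using \<beta> by (simp add: abs_mult A_def J_def U_def abs_square_le_1)
  qed
  have dcont: "continuous_on R (deriv q)"
    by (rule holomorphic_on_imp_continuous_on[OF holomorphic_on_subset[OF holomorphic_deriv[OF q(1,2)] q(3)]])
  have Jcont: "continuous_on (cbox (a, c) (b, d)) (\<lambda>p. J (fst p) (snd p))"
    unfolding J_def
    by (intro continuous_intros continuous_on_compose2[OF dcont])
       (auto simp: R_def in_cbox_complex_iff)
  define I where "I = integral {a..b} (\<lambda>s. integral {c..d} (\<lambda>t. J s t))"
  have "((\<lambda>x. J (x$1) (x$2)) has_integral I) S'"
    using has_integral_real2[OF Jcont] by (simp add: S'_def I_def)
  hence hint: "((\<lambda>x. \<bar>det (matrix (P' x))\<bar>) has_integral (1 - (cmod \<beta>)\<^sup>2) * I) S"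
    unfolding det S_def S'_def has_integral_open_interval by (rule has_integral_mult_right)
  have Sm: "S \<in> sets lebesgue" unfolding S_def by simp
  from hint have "P ` S \<in> lmeasurable \<and> measure lebesgue (P ` S) = (1 - (cmod \<beta>)\<^sup>2) * I"
    using has_measure_differentiable_image[OF Sm der Pinj] by blast
  moreover have "measure lebesgue (P ` S) \<le> measure lebesgue (cball (0 :: real^2) K)"
    using calculation K US
    by (intro measure_mono_fmeasurable) (auto simp: P_def normT L_def)
  moreover have "measure lebesgue (cball (0 :: real^2) K) = pi * K\<^sup>2"
    using K(2) by (simp add: content_cball unit_ball_vol_2)
  ultimately show ?thesis by (simp add: I_def J_def)
qed

text \<open>The substitution z = exp \<zeta> turns the annulus, cut along the positive real axis,
  into a rectangle on which exp is injective. The inner integrals run over circles, where Parseval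
  bounds them below by finitely many coefficients.\<close>

lemma annulus_image_area:
  fixes V :: "complex fps" and \<delta> \<rho> K :: real and \<beta> :: complex
  assumes v: "v has_fps_expansion V" "v holomorphic_on ball 0 1"
    and inj: "inj_on (\<lambda>z. 1 / z + v z) (ball 0 1 - {0})"
    and \<delta>: "0 < \<delta>" "\<delta> < \<rho>" "\<rho> < 1" and \<beta>: "cmod \<beta> < 1"
    and K: "\<And>z. \<delta> < cmod z \<Longrightarrow> cmod z < \<rho> \<Longrightarrow> cmod ((1 / z + v z) - \<beta> * cnj (1 / z + v z)) \<le> K" "0 \<le> K"
  shows "(1 - (cmod \<beta>)\<^sup>2) * (1 / \<delta>\<^sup>2 - 1 / \<rho>\<^sup>2 + (\<Sum>j\<le>n. real j * (cmod (fps_nth V j))\<^sup>2 * (\<rho> ^ (2*j) - \<delta> ^ (2*j)))) \<le> K\<^sup>2"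
proof -
  \<comment> \<open>This is z^2 times the derivative of 1/z + v(z), so the pole is gone; in the
    logarithmic coordinate the derivative is g(z)/z.\<close>
  define G where "G = - 1 + fps_X ^ 2 * fps_deriv V"
  define g where "g = (\<lambda>z. - 1 + z ^ 2 * deriv v z)"
  have g: "g has_fps_expansion G"
    unfolding g_def G_def
    by (intro has_fps_expansion_add has_fps_expansion_minus has_fps_expansion_1 has_fps_expansion_mult
          has_fps_expansion_fps_X_power has_fps_expansion_deriv v)
  have hg: "g holomorphic_on ball 0 1"
    unfolding g_def by (intro holomorphic_intros holomorphic_deriv v) auto
  have G0: "fps_nth G 0 = -1" by (simp add: G_def)
  have GS: "fps_nth G (Suc j) = of_nat j * fps_nth V j" for j
    by (cases j) (simp_all add: G_def fps_X_power_mult_nth)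
  define q where "q = (\<lambda>\<zeta>. 1 / exp \<zeta> + v (exp \<zeta>))"
  define \<Omega> where "\<Omega> = {\<zeta>. Re \<zeta> < 0}"
  have exp_disc: "exp \<zeta> \<in> ball 0 1" if "\<zeta> \<in> \<Omega>" for \<zeta> :: complex
    using that by (simp add: \<Omega>_def)
  have dq: "(q has_field_derivative g (exp \<zeta>) / exp \<zeta>) (at \<zeta>)" if "\<zeta> \<in> \<Omega>" for \<zeta>
  proof -
    have "(v has_field_derivative deriv v (exp \<zeta>)) (at (exp \<zeta>))"
      by (rule holomorphic_derivI[OF v(2) _ exp_disc[OF that]]) auto
    thus ?thesis
      unfolding q_def g_def
      by (auto intro!: derivative_eq_intros DERIV_chain2[of v] simp: field_simps power2_eq_square)
  qed
  have op: "open \<Omega>" unfolding \<Omega>_def by (rule open_halfspace_Re_lt)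
  have hq: "q holomorphic_on \<Omega>"
    using dq op by (auto simp: holomorphic_on_open)
  have ln: "ln \<delta> < ln \<rho>" "ln \<rho> < 0" using \<delta> by auto
  have "cbox (Complex (ln \<delta>) 0) (Complex (ln \<rho>) (2*pi)) \<subseteq> \<Omega>"
    using ln by (auto simp: in_cbox_complex_iff \<Omega>_def)
  note sub = this
  have injq: "inj_on q (box (Complex (ln \<delta>) 0) (Complex (ln \<rho>) (2*pi)))" (is "inj_on q ?R0")
  proof (rule inj_onI)
    fix x y assume xy: "x \<in> ?R0" "y \<in> ?R0" "q x = q y"
    hence "x \<in> \<Omega>" "y \<in> \<Omega>" using sub box_subset_cbox by blast+
    hence "exp x = exp y"
      using inj_onD[OF inj, of "exp x" "exp y"] xy(3) exp_disc[of x] exp_disc[of y] by (auto simp: q_def)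
    thus "x = y"
      by (rule exp_complex_eqI[rotated]) (use xy in \<open>auto simp: in_box_complex_iff\<close>)
  qed
  have Kq: "cmod (q z - \<beta> * cnj (q z)) \<le> K" if "z \<in> ?R0" for z
  proof -
    have "ln \<delta> < Re z" "Re z < ln \<rho>" using that by (auto simp: in_box_complex_iff)
    hence "\<delta> < exp (Re z)" "exp (Re z) < \<rho>"
      using \<delta> by (metis exp_less_cancel_iff exp_ln less_trans)+
    thus ?thesis unfolding q_def by (intro K) auto
  qed
  define J where "J = (\<lambda>(s::real) (t::real). (cmod (deriv q (Complex s t)))\<^sup>2)"
  define A where "A = (\<lambda>s. integral {0..2*pi} (J s))"
  have area: "(1 - (cmod \<beta>)\<^sup>2) * integral {ln \<delta>..ln \<rho>} A \<le> pi * K\<^sup>2"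
    unfolding A_def J_def by (rule area_bound_rectangle[OF hq op sub injq \<beta> Kq K(2)])
  have J: "J s t = exp (- 2 * s) * (cmod (g (exp s * cis t)))\<^sup>2" if "s < 0" for s t
  proof -
    have "deriv q (Complex s t) = g (exp (Complex s t)) / exp (Complex s t)"
      using that by (intro DERIV_imp_deriv dq) (simp add: \<Omega>_def)
    moreover have "exp (- 2 * s) = 1 / (exp s)\<^sup>2"
      by (simp add: exp_minus divide_inverse flip: exp_double)
    ultimately show ?thesis
      by (simp add: J_def exp_eq_polar norm_divide norm_mult power_divide)
  qed
  \<comment> \<open>The Parseval sum of g on the circle of radius e^s, cut after index n + 1 and
    multiplied by e^(-2s); it has the explicit primitive \<open>H\<close> below.\<close>
  define D where "D = (\<lambda>s. 2 * pi * (exp (- 2 * s) + (\<Sum>j\<le>n. (real j * cmod (fps_nth V j))\<^sup>2 * exp (2 * real j * s))))"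
  have A_ge: "D s \<le> A s" if s: "s < 0" for s
  proof -
    have s': "0 \<le> exp s" "exp s < 1" using s by auto
    have e: "exp (- 2 * s) * exp s ^ (2 * Suc j) = exp (2 * real j * s)" for j
      unfolding exp_of_nat_mult[symmetric] mult_exp_exp by (simp add: algebra_simps)
    have "D s = 2 * pi * exp (- 2 * s) + (\<Sum>j\<le>n. 2 * pi * ((real j * cmod (fps_nth V j))\<^sup>2 * (exp (- 2 * s) * exp s ^ (2 * Suc j))))"
      unfolding e D_def by (simp only: distrib_left sum_distrib_left)
    also have "\<dots> = exp (- 2 * s) * (\<Sum>k\<le>Suc n. 2 * pi * ((cmod (fps_nth G k))\<^sup>2 * exp s ^ (2*k)))"
      unfolding sum.atMost_Suc_shift G0 GS norm_mult norm_of_nat distrib_left sum_distrib_left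
      by (intro arg_cong2[where f = "(+)"] sum.cong) simp_all
    also have "\<dots> \<le> exp (- 2 * s) * integral {0..2*pi} (\<lambda>t. (cmod (g (exp s * cis t)))\<^sup>2)"
      unfolding sums_unique[OF parseval_disc[OF g hg s']]
      by (intro mult_left_mono sum_le_suminf sums_summable[OF parseval_disc[OF g hg s']]) auto
    also have "\<dots> = A s"
      unfolding A_def by (subst J[OF s, abs_def]) (simp add: exp_of_real)
    finally show ?thesis .
  qed
  have Dint: "(D has_integral pi * (1 / \<delta>\<^sup>2 - 1 / \<rho>\<^sup>2 + (\<Sum>j\<le>n. real j * (cmod (fps_nth V j))\<^sup>2 * (\<rho> ^ (2*j) - \<delta> ^ (2*j))))) {ln \<delta>..ln \<rho>}"
  proof -
    define H where "H = (\<lambda>s. pi * (- exp (- 2 * s) + (\<Sum>j\<le>n. real j * (cmod (fps_nth V j))\<^sup>2 * exp (2 * real j * s))))"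
    have "(H has_real_derivative D s) (at s within X)" for s X
      unfolding H_def D_def
      by (auto intro!: derivative_eq_intros sum.cong simp: sum_distrib_left power2_eq_square algebra_simps)
    hence "(D has_integral H (ln \<rho>) - H (ln \<delta>)) {ln \<delta>..ln \<rho>}"
      using ln by (intro fundamental_theorem_of_calculus) (auto simp: has_real_derivative_iff_has_vector_derivative)
    moreover have "H (ln x) = pi * (- 1 / x\<^sup>2 + (\<Sum>j\<le>n. real j * (cmod (fps_nth V j))\<^sup>2 * x ^ (2*j)))" if "x > 0" for x
    proof -
      have "exp (2 * real j * ln x) = x ^ (2*j)" for j
        using exp_of_nat_mult[of "2*j" "ln x"] that by simp
      moreover have "exp (-2 * ln x) = 1 / x\<^sup>2"
        using that by (simp add: exp_minus exp_double divide_inverse)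
      ultimately show ?thesis unfolding H_def by simp
    qed
    ultimately show ?thesis
      using \<delta> by (simp add: algebra_simps sum_subtractf)
  qed
  have "continuous_on {ln \<delta>..ln \<rho>} A"
  proof -
    have "continuous_on ({ln \<delta>..ln \<rho>} \<times> cbox 0 (2*pi)) (\<lambda>(s, t). J s t)"
      unfolding J_def case_prod_beta
      by (intro continuous_intros continuous_on_compose2[OF holomorphic_on_imp_continuous_on[OF holomorphic_deriv[OF hq op]]])
        (use ln in \<open>auto simp: \<Omega>_def\<close>)
    from integral_continuous_on_param[OF this] show ?thesis by (simp add: A_def)
  qed
  hence Aint: "A integrable_on {ln \<delta>..ln \<rho>}"
    by (rule integrable_continuous_interval)
  have "integral {ln \<delta>..ln \<rho>} D \<le> integral {ln \<delta>..ln \<rho>} A"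
    using Dint ln by (intro integral_le Aint A_ge) auto
  hence "(1 - (cmod \<beta>)\<^sup>2) * integral {ln \<delta>..ln \<rho>} D \<le> (1 - (cmod \<beta>)\<^sup>2) * integral {ln \<delta>..ln \<rho>} A"
    using \<beta> by (intro mult_left_mono) (auto simp: abs_square_le_1)
  also note area
  finally have "pi * ((1 - (cmod \<beta>)\<^sup>2) * (1 / \<delta>\<^sup>2 - 1 / \<rho>\<^sup>2 + (\<Sum>j\<le>n. real j * (cmod (fps_nth V j))\<^sup>2 * (\<rho> ^ (2*j) - \<delta> ^ (2*j))))) \<le> pi * K\<^sup>2"
    unfolding integral_unique[OF Dint] by (simp only: mult.left_commute)
  thus ?thesis by simp
qed

lemma holomorphic_difference_quotient:
  fixes V :: "complex fps"
  assumes v: "v has_fps_expansion V" "v holomorphic_on ball 0 1"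
  obtains u where "u has_fps_expansion fps_shift 1 V" "u holomorphic_on ball 0 1" "\<And>z. v z = v 0 + z * u z"
proof -
  define u where "u = (\<lambda>z. if z = 0 then deriv v 0 else (v z - v 0) / (z - 0))"
  have hol: "u holomorphic_on ball 0 1"
    unfolding u_def by (rule pole_lemma[OF v(2)]) auto
  have eq: "v z = v 0 + z * u z" for z by (simp add: u_def)
  have uf: "u has_fps_expansion fps_expansion u 0"
    by (rule has_fps_expansion_fps_expansion[OF _ _ hol]) auto
  have "(\<lambda>z. v 0 + z * u z) has_fps_expansion fps_const (v 0) + fps_X * fps_expansion u 0"
    by (intro has_fps_expansion_add has_fps_expansion_const has_fps_expansion_mult has_fps_expansion_fps_X uf)
  moreover have "(\<lambda>z. v 0 + z * u z) = v" by (rule ext) (rule eq[symmetric])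
  ultimately have "V = fps_const (v 0) + fps_X * fps_expansion u 0"
    using fps_expansion_unique_complex v(1) by metis
  hence "fps_shift 1 V = fps_expansion u 0"
    by (simp add: fps_eq_iff)
  with uf have "u has_fps_expansion fps_shift 1 V" by simp
  from that[OF this hol eq] show ?thesis .
qed

text \<open>Gronwall's inequality. The image of the annulus \<delta> < |z| < \<rho> is compared with
  a disc of radius K; then \<delta> tends to 0 and \<rho> to 1. The triangle inequality alone gives
  K = 1/\<delta> + O(\<delta>), where K^2 - 1/\<delta>^2 is bounded but need not vanish. The choice
  of \<beta> improves this to K = 1/\<delta> + O(\<delta>^2), whose excess is O(\<delta>).\<close>

theorem area_theorem:
  fixes V :: "complex fps"
  assumes v: "v has_fps_expansion V" "v holomorphic_on ball 0 1"
    and inj: "inj_on (\<lambda>z. 1 / z + v z) (ball 0 1 - {0})"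
  shows "(\<Sum>j\<le>n. real j * (cmod (fps_nth V j))\<^sup>2) \<le> 1"
proof -
  obtain v1 where v1: "v1 has_fps_expansion fps_shift 1 V" "v1 holomorphic_on ball 0 1" "\<And>z. v z = v 0 + z * v1 z"
    using holomorphic_difference_quotient[OF v] by metis
  obtain u where u: "u holomorphic_on ball 0 1" "\<And>z. v1 z = v1 0 + z * u z"
    using holomorphic_difference_quotient[OF v1(1,2)] by metis
  define b where "b = v1 0"
  define c where "c = (\<lambda>j. real j * (cmod (fps_nth V j))\<^sup>2)"
  define k where "k = (\<lambda>z. 1 / z + z * v1 z)"
  \<comment> \<open>The constant term is a translation: it affects neither injectivity nor the sum,
    but would spoil K by a term of order 1.\<close>
  have keq: "1 / z + v z = k z + v 0" for z using v1(3)[of z] by (simp add: k_def)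
  have "(\<lambda>z. z * v1 z) has_fps_expansion fps_X * fps_shift 1 V"
    by (intro has_fps_expansion_mult has_fps_expansion_fps_X v1)
  moreover have "(\<lambda>z. z * v1 z) holomorphic_on ball 0 1"
    by (intro holomorphic_intros v1)
  moreover have "inj_on (\<lambda>z. 1 / z + z * v1 z) (ball 0 1 - {0})"
    using inj by (auto simp: inj_on_def keq k_def)
  ultimately have area: "(1 - (cmod \<beta>)\<^sup>2) * (1 / \<delta>\<^sup>2 - 1 / \<rho>\<^sup>2 + (\<Sum>j\<le>n. c j * (\<rho> ^ (2*j) - \<delta> ^ (2*j)))) \<le> K\<^sup>2"
    if "0 < \<delta>" "\<delta> < \<rho>" "\<rho> < 1" "cmod \<beta> < 1" "0 \<le> K"
      "\<And>z. \<delta> < cmod z \<Longrightarrow> cmod z < \<rho> \<Longrightarrow> cmod (k z - \<beta> * cnj (k z)) \<le> K" for \<delta> \<rho> \<beta> K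
  proof -
    have "c j = real j * (cmod (fps_nth (fps_X * fps_shift 1 V) j))\<^sup>2" for j
      by (cases j) (simp_all add: c_def)
    thus ?thesis
      using annulus_image_area[of "\<lambda>z. z * v1 z" "fps_X * fps_shift 1 V" \<delta> \<rho> \<beta> K n]
        \<open>(\<lambda>z. z * v1 z) has_fps_expansion _\<close> \<open>(\<lambda>z. z * v1 z) holomorphic_on _\<close> \<open>inj_on (\<lambda>z. 1 / z + z * v1 z) _\<close> that
      by (simp add: k_def)
  qed
  have le: "(\<Sum>j\<le>n. c j * \<rho> ^ (2*j)) \<le> 1 / \<rho>\<^sup>2" if \<rho>: "0 < \<rho>" "\<rho> < 1" for \<rho>
  proof -
    have cball: "cball 0 \<rho> \<subseteq> ball (0 :: complex) 1" using \<rho> by auto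
    have bdd: "\<exists>B. \<forall>z\<in>cball 0 \<rho>. cmod (f z) \<le> B" if "f holomorphic_on ball 0 1" for f
    proof -
      have "compact (f ` cball 0 \<rho>)"
        by (intro compact_continuous_image holomorphic_on_imp_continuous_on[OF holomorphic_on_subset[OF that cball]]) auto
      hence "bounded (f ` cball 0 \<rho>)" by (rule compact_imp_bounded)
      thus ?thesis by (auto simp: bounded_iff)
    qed
    obtain B1 where B1: "\<forall>z\<in>cball 0 \<rho>. cmod (v1 z) \<le> B1" using bdd[OF v1(2)] by blast
    obtain B2 where B2: "\<forall>z\<in>cball 0 \<rho>. cmod (u z) \<le> B2" using bdd[OF u(1)] by blast
    define M where "M = max 0 (max B1 B2)"
    have M: "0 \<le> M" "\<And>z. cmod z \<le> \<rho> \<Longrightarrow> cmod (v1 z) \<le> M" "\<And>z. cmod z \<le> \<rho> \<Longrightarrow> cmod (u z) \<le> M"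
      using B1 B2 unfolding M_def by (auto simp: le_max_iff_disj)
    have bM: "cmod b \<le> M" unfolding b_def using M(2)[of 0] \<rho> by simp
    define C where "C = M + M\<^sup>2"
    have C0: "0 \<le> C" using M(1) by (simp add: C_def)
    define X where "X = (\<lambda>\<delta>. (\<Sum>j\<le>n. c j * (\<rho> ^ (2*j) - \<delta> ^ (2*j))) - 1 / \<rho>\<^sup>2)"
    \<comment> \<open>The terms 1/\<delta>^2 on both sides have cancelled; the right-hand side
      vanishes and the factor of \<open>X \<delta>\<close> tends to 1 as \<delta> tends to
      0.\<close>
    have key: "X \<delta> * (1 - (cmod b)\<^sup>2 * \<delta> ^ 4) \<le> (cmod b)\<^sup>2 * \<delta>\<^sup>2 + 2 * C * \<delta> + C\<^sup>2 * \<delta> ^ 4"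
      if \<delta>: "0 < \<delta>" "\<delta> < min \<rho> (1 / (4 * M + 1))" for \<delta>
    proof -
      have \<delta>1: "\<delta> < \<rho>" "\<delta> < 1" "4 * M * \<delta> \<le> 1" "M * \<delta> < 1"
        using \<delta> \<rho> M(1) by (auto simp: field_simps)
      define \<beta> where "\<beta> = b * \<delta>\<^sup>2"
      have "cmod b * \<delta>\<^sup>2 \<le> M * \<delta>\<^sup>2" by (intro mult_right_mono bM) auto
      also have "\<dots> \<le> M * \<delta>" using \<delta> \<delta>1 M(1) by (intro mult_left_mono) (auto simp: power2_eq_square mult_left_le_one_le)
      finally have \<beta>1: "cmod \<beta> < 1" using \<delta>1 by (simp add: \<beta>_def norm_mult norm_power)
      \<comment> \<open>For \<open>\<bar>z\<bar> = \<delta>\<close> the term \<open>b z\<close> of \<open>k z\<close> is cancelled by the leading term of \<open>\<beta> cnj (k z)\<close>, so the image of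
        the circle under the affine map is within \<open>O(\<delta>\<^sup>2)\<close> of a circle; this keeps the error \<open>o(1)\<close>.\<close>
      have bound: "cmod (k z - \<beta> * cnj (k z)) \<le> 1 / \<delta> + C * \<delta>\<^sup>2" if z: "\<delta> < cmod z" "cmod z < \<rho>" for z
      proof -
        define s where "s = cmod z"
        have s: "\<delta> < s" "s < 1" "s > 0" "s \<le> \<rho>" using z \<delta> \<rho> by (auto simp: s_def)
        have z0: "z \<noteq> 0" using s by (auto simp: s_def)
        have zz: "z * cnj z = s\<^sup>2" unfolding s_def by (simp only: complex_norm_square)
        have "k z - \<beta> * cnj (k z) = 1 / z + b * (z - \<delta>\<^sup>2 / cnj z) + z\<^sup>2 * u z - \<beta> * cnj (z * v1 z)"
        proof -
          have "k z = 1 / z + b * z + z\<^sup>2 * u z"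
            unfolding k_def u(2)[of z] b_def by (simp add: algebra_simps power2_eq_square)
          moreover have "\<beta> * cnj (k z) = b * (\<delta>\<^sup>2 / cnj z) + \<beta> * cnj (z * v1 z)"
            by (simp add: k_def \<beta>_def algebra_simps)
          ultimately show ?thesis by (simp add: algebra_simps)
        qed
        also have "z - \<delta>\<^sup>2 / cnj z = of_real (s\<^sup>2 - \<delta>\<^sup>2) / cnj z"
          using z0 zz by (simp add: field_simps)
        finally have "cmod (k z - \<beta> * cnj (k z)) \<le> cmod (1 / z) + cmod (b * (of_real (s\<^sup>2 - \<delta>\<^sup>2) / cnj z)) + cmod (z\<^sup>2 * u z) + cmod (\<beta> * cnj (z * v1 z))"
          by (simp only:) (intro order_trans[OF norm_triangle_ineq4] add_mono order_trans[OF norm_triangle_ineq] order_refl)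
        also have "cmod (1 / z) = 1 / s" by (simp add: norm_divide s_def)
        also have "cmod (b * (of_real (s\<^sup>2 - \<delta>\<^sup>2) / cnj z)) = cmod b * (s\<^sup>2 - \<delta>\<^sup>2) / s"
        proof -
          have "\<delta>\<^sup>2 \<le> s\<^sup>2" using s \<delta> by (intro power_mono) auto
          thus ?thesis unfolding norm_mult norm_divide norm_of_real by (simp add: s_def)
        qed
        also have "\<dots> \<le> M * (s\<^sup>2 - \<delta>\<^sup>2) / s"
          using s \<delta> bM by (intro divide_right_mono mult_right_mono) (auto intro!: power_mono)
        also have "cmod (z\<^sup>2 * u z) \<le> s\<^sup>2 * M"
          unfolding norm_mult norm_power s_def[symmetric] using s M(3)[of z] by (intro mult_left_mono) (auto simp: s_def)
        also have "cmod (\<beta> * cnj (z * v1 z)) \<le> (M * \<delta>\<^sup>2) * (1 * M)"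
          unfolding norm_mult complex_mod_cnj s_def[symmetric] \<beta>_def norm_power norm_of_real
          using s bM M(2)[of z] \<delta> M(1) by (intro mult_mono) (auto simp: s_def norm_mult norm_power intro!: mult_right_mono)
        finally have 1: "cmod (k z - \<beta> * cnj (k z)) \<le> 1 / s + M * (s\<^sup>2 - \<delta>\<^sup>2) / s + s\<^sup>2 * M + M * \<delta>\<^sup>2 * (1 * M)"
          by simp
        have "M * (s\<^sup>2 - \<delta>\<^sup>2) * s \<le> M * (s\<^sup>2 - \<delta>\<^sup>2) * 1"
          using s \<delta> M(1) by (intro mult_left_mono mult_nonneg_nonneg) (auto intro!: power_mono)
        hence 2: "M * (s\<^sup>2 - \<delta>\<^sup>2) \<le> M * (s\<^sup>2 - \<delta>\<^sup>2) / s"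
          using s by (simp add: field_simps)
        \<comment> \<open>Away from the inner circle the main term drops from 1/\<delta> to 1/s, and
          this gain pays for two errors of size M (s^2 - \<delta>^2)/s, one from \<open>b\<close>
          and one from \<open>u\<close>. The condition 4 M \<delta> <= 1 was imposed for
          this.\<close>
        have "2 * M * (s + \<delta>) * \<delta> \<le> 2 * M * 2 * \<delta>"
          using s \<delta> \<delta>1 M(1) by (intro mult_mono) auto
        also have "\<dots> \<le> 1" using \<delta>1 by simp
        finally have "(s - \<delta>) * (2 * M * (s + \<delta>) * \<delta>) \<le> (s - \<delta>) * 1"
          using s by (intro mult_left_mono) auto
        hence "(s - \<delta>) * (2 * M * (s + \<delta>) * \<delta>) / (\<delta> * s) \<le> (s - \<delta>) * 1 / (\<delta> * s)"
          using s \<delta> by (intro divide_right_mono) auto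
        also have "(s - \<delta>) * 1 / (\<delta> * s) = 1 / \<delta> - 1 / s"
          using s \<delta> by (simp add: field_simps)
        also have "(s - \<delta>) * (2 * M * (s + \<delta>) * \<delta>) / (\<delta> * s) = 2 * (M * (s\<^sup>2 - \<delta>\<^sup>2) / s)"
          using s \<delta> by (simp add: field_simps power2_eq_square)
        finally have 3: "2 * (M * (s\<^sup>2 - \<delta>\<^sup>2) / s) \<le> 1 / \<delta> - 1 / s" .
        have "s\<^sup>2 * M = M * (s\<^sup>2 - \<delta>\<^sup>2) + M * \<delta>\<^sup>2" "C * \<delta>\<^sup>2 = M * \<delta>\<^sup>2 + M * \<delta>\<^sup>2 * (1 * M)"
          by (simp_all add: C_def algebra_simps power2_eq_square)
        with 1 2 3 show ?thesis by linarith
      qed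
      have "(1 - (cmod \<beta>)\<^sup>2) * (1 / \<delta>\<^sup>2 - 1 / \<rho>\<^sup>2 + (\<Sum>j\<le>n. c j * (\<rho> ^ (2*j) - \<delta> ^ (2*j)))) \<le> (1 / \<delta> + C * \<delta>\<^sup>2)\<^sup>2"
        by (rule area[OF \<delta>(1) \<delta>1(1) \<rho>(2) \<beta>1 _ bound]) (use \<delta> C0 in auto)
      also have "1 / \<delta>\<^sup>2 - 1 / \<rho>\<^sup>2 + (\<Sum>j\<le>n. c j * (\<rho> ^ (2*j) - \<delta> ^ (2*j))) = 1 / \<delta>\<^sup>2 + X \<delta>"
        by (simp add: X_def)
      also have "(1 / \<delta> + C * \<delta>\<^sup>2)\<^sup>2 = 1 / \<delta>\<^sup>2 + 2 * C * \<delta> + C\<^sup>2 * \<delta> ^ 4"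
        using \<delta> by (simp add: field_simps power2_eq_square power4_eq_xxxx)
      also have "(cmod \<beta>)\<^sup>2 = (cmod b)\<^sup>2 * \<delta> ^ 4"
        by (simp add: \<beta>_def norm_mult norm_power power_mult_distrib flip: power_mult)
      also have "(1 - (cmod b)\<^sup>2 * \<delta> ^ 4) * (1 / \<delta>\<^sup>2 + X \<delta>) = 1 / \<delta>\<^sup>2 - (cmod b)\<^sup>2 * \<delta>\<^sup>2 + X \<delta> * (1 - (cmod b)\<^sup>2 * \<delta> ^ 4)"
        using \<delta> by (simp add: field_simps power2_eq_square power4_eq_xxxx)
      finally show ?thesis by simp
    qed
    have "((\<lambda>\<delta>. X \<delta> * (1 - (cmod b)\<^sup>2 * \<delta> ^ 4)) \<longlongrightarrow> X 0 * (1 - (cmod b)\<^sup>2 * 0 ^ 4)) (at_right 0)"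
      unfolding X_def by (intro tendsto_intros)
    moreover have "((\<lambda>\<delta>. (cmod b)\<^sup>2 * \<delta>\<^sup>2 + 2 * C * \<delta> + C\<^sup>2 * \<delta> ^ 4) \<longlongrightarrow> (cmod b)\<^sup>2 * 0\<^sup>2 + 2 * C * 0 + C\<^sup>2 * 0 ^ 4) (at_right 0)"
      by (intro tendsto_intros)
    moreover have "\<forall>\<^sub>F \<delta> in at_right 0. X \<delta> * (1 - (cmod b)\<^sup>2 * \<delta> ^ 4) \<le> (cmod b)\<^sup>2 * \<delta>\<^sup>2 + 2 * C * \<delta> + C\<^sup>2 * \<delta> ^ 4"
      by (rule eventually_mono[OF eventually_at_right_real[of 0 "min \<rho> (1 / (4 * M + 1))"]])
        (use \<rho> M(1) key in auto)
    ultimately have "X 0 * (1 - (cmod b)\<^sup>2 * 0 ^ 4) \<le> (cmod b)\<^sup>2 * 0\<^sup>2 + 2 * C * 0 + C\<^sup>2 * 0 ^ 4"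
      by (intro tendsto_le[where F = "at_right 0"]) auto
    hence "X 0 \<le> 0" by simp
    \<comment> \<open>For j = 0 the power \<open>0 ^ 0\<close> is 1, but
      \<open>c 0 = 0\<close>.\<close>
    moreover have "c j * (\<rho> ^ (2*j) - 0 ^ (2*j)) = c j * \<rho> ^ (2*j)" for j
      by (cases j) (auto simp: c_def)
    ultimately show ?thesis by (simp add: X_def)
  qed
  have "((\<lambda>\<rho>. \<Sum>j\<le>n. c j * \<rho> ^ (2*j)) \<longlongrightarrow> (\<Sum>j\<le>n. c j * 1 ^ (2*j))) (at_left 1)"
    by (intro tendsto_intros)
  moreover have "((\<lambda>\<rho>::real. 1 / \<rho>\<^sup>2) \<longlongrightarrow> 1 / 1\<^sup>2) (at_left 1)"
    by (intro tendsto_intros) auto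
  moreover have "\<forall>\<^sub>F \<rho> in at_left 1. (\<Sum>j\<le>n. c j * \<rho> ^ (2*j)) \<le> 1 / \<rho>\<^sup>2"
    by (rule eventually_mono[OF eventually_at_left_real[of 0 1]]) (use le in auto)
  ultimately have "(\<Sum>j\<le>n. c j * 1 ^ (2*j)) \<le> 1 / 1\<^sup>2"
    by (intro tendsto_le[where F = "at_left (1::real)"]) auto
  thus ?thesis by (simp add: c_def)
qed

section \<open>Univalent functions\<close>

text \<open>The summand \<open>j = 0\<close> equals \<open>- 1\<close>, so the last conclusion reads \<open>\<Sum> (2 j - 1) |t\<^sub>j|\<^sup>2 \<le> 1\<close> over \<open>j \<ge> 1\<close>.\<close>

lemma univalent_sqrt_transform:
  fixes \<Phi> :: "complex fps"
  assumes \<phi>: "\<phi> has_fps_expansion \<Phi>" "\<phi> holomorphic_on ball 0 1" and inj: "inj_on \<phi> (ball 0 1)" and \<phi>0: "\<phi> 0 = 0"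
  obtains S where "fps_nth \<Phi> 1 \<noteq> 0" "\<Phi> = fps_const (fps_nth \<Phi> 1) * fps_X * S ^ 2" "fps_nth S 0 = 1"
    "\<And>n. (\<Sum>j\<le>n. (2 * real j - 1) * (cmod (fps_nth (inverse S) j))\<^sup>2) \<le> 0"
proof -
  obtain u where u: "u has_fps_expansion fps_shift 1 \<Phi>" "u holomorphic_on ball 0 1" "\<And>z. \<phi> z = \<phi> 0 + z * u z"
    by (rule holomorphic_difference_quotient[OF \<phi>(1,2)]) (rule that)
  have \<phi>u: "\<phi> z = z * u z" for z using u(3)[of z] by (simp add: \<phi>0)
  define c where "c = fps_nth \<Phi> 1"
  have uc: "u 0 = c"
    using has_fps_expansion_imp_0_eq_fps_nth_0[OF u(1)] by (simp add: c_def)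
  have u0: "u z \<noteq> 0" if "z \<in> ball 0 1" for z
  proof (cases "z = 0")
    case True
    have "(\<phi> has_field_derivative deriv \<phi> 0) (at 0)"
      by (rule holomorphic_derivI[OF \<phi>(2)]) auto
    moreover have "(u has_field_derivative deriv u 0) (at 0)"
      by (rule holomorphic_derivI[OF u(2)]) auto
    hence "((\<lambda>z. z * u z) has_field_derivative u 0) (at 0)"
      by (auto intro!: derivative_eq_intros)
    hence "(\<phi> has_field_derivative u 0) (at 0)" by (simp add: \<phi>u[abs_def])
    ultimately have "u 0 = deriv \<phi> 0" using DERIV_unique by blast
    also have "\<dots> \<noteq> 0" by (rule holomorphic_injective_imp_regular[OF \<phi>(2) _ inj]) auto
    finally show ?thesis using True by simp
  next
    case False
    hence "\<phi> z \<noteq> \<phi> 0" using inj_onD[OF inj, of z 0] that by auto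
    thus ?thesis using \<phi>u[of z] \<phi>0 by auto
  qed
  have c0: "c \<noteq> 0" using u0[of 0] uc by simp
  have "contractible (ball 0 1 :: complex set)" by (intro convex_imp_contractible) auto
  moreover have "(\<lambda>z. u z / c) holomorphic_on ball 0 1" by (intro holomorphic_intros u c0)
  moreover have "u z / c \<noteq> 0" if "z \<in> ball 0 1" for z using u0[OF that] c0 by simp
  ultimately obtain s0 where s0: "s0 holomorphic_on ball 0 1" "\<And>z. z \<in> ball 0 1 \<Longrightarrow> u z / c = s0 z ^ 2"
    using contractible_imp_holomorphic_sqrt[of "\<lambda>z. u z / c" "ball 0 1"] by blast
  \<comment> \<open>The root is only determined up to sign; multiplying by \<open>s0 0\<close>,
    which is 1 or -1, normalises it to s(0) = 1.\<close>
  define s where "s = (\<lambda>z. s0 0 * s0 z)"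
  have s00: "s0 0 ^ 2 = 1" using s0(2)[of 0] c0 by (simp add: uc)
  have hs: "s holomorphic_on ball 0 1" unfolding s_def by (intro holomorphic_intros s0)
  have us: "u z = c * s z ^ 2" if "z \<in> ball 0 1" for z
  proof -
    have "u z = c * s0 z ^ 2" using s0(2)[OF that] c0 by (simp add: field_simps)
    thus ?thesis unfolding s_def power_mult_distrib s00 by simp
  qed
  have s_nz: "s z \<noteq> 0" if "z \<in> ball 0 1" for z using us[OF that] u0[OF that] by auto
  define S where "S = fps_expansion s 0"
  have S: "s has_fps_expansion S"
    unfolding S_def by (rule has_fps_expansion_fps_expansion[OF _ _ hs]) auto
  have S0: "fps_nth S 0 = 1"
    using has_fps_expansion_imp_0_eq_fps_nth_0[OF S] s00 by (simp add: s_def power2_eq_square)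
  have "(\<lambda>z. c * z * s z ^ 2) has_fps_expansion fps_const c * fps_X * S ^ 2"
    by (intro has_fps_expansion_mult has_fps_expansion_const has_fps_expansion_fps_X has_fps_expansion_power S)
  moreover have "\<forall>\<^sub>F z in nhds 0. c * z * s z ^ 2 = \<phi> z"
    using eventually_nhds_in_open[of "ball 0 1" "0::complex"] by (auto elim!: eventually_mono simp: \<phi>u us)
  ultimately have "\<phi> has_fps_expansion fps_const c * fps_X * S ^ 2"
    using has_fps_expansion_cong[of "\<lambda>z. c * z * s z ^ 2" \<phi>] by blast
  hence \<Phi>: "\<Phi> = fps_const c * fps_X * S ^ 2"
    using fps_expansion_unique_complex \<phi>(1) by blast
  define T where "T = inverse S"
  \<comment> \<open>With \<tau>(z) = 1 + z v(z), the function 1/z + v(z) equals 1/(z s(z^2)) away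
    from 0, and c (z s(z^2))^2 = \<phi>(z^2) ties its injectivity to that of \<phi>.\<close>
  define \<tau> where "\<tau> = (\<lambda>z. inverse (s (z ^ 2)))"
  have sq: "z ^ 2 \<in> ball 0 1" if "z \<in> ball 0 1" for z :: complex
    using that by (simp add: norm_power power_less_one_iff)
  have "(inverse \<circ> s \<circ> (\<lambda>z. z ^ 2)) has_fps_expansion (T oo fps_X ^ 2)"
    unfolding T_def o_assoc[symmetric]
    using has_fps_expansion_compose[OF has_fps_expansion_inverse[OF S] has_fps_expansion_fps_X_power[of 2]] S0
    by (simp add: o_def)
  hence \<tau>: "\<tau> has_fps_expansion (T oo fps_X ^ 2)" by (simp add: \<tau>_def o_def)
  have "\<tau> holomorphic_on ball 0 1"
    unfolding \<tau>_def
    by (intro holomorphic_on_inverse holomorphic_on_compose_gen[OF _ hs, unfolded o_def] holomorphic_intros)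
      (use sq s_nz in auto)
  then obtain v where
    v: "v has_fps_expansion fps_shift 1 (T oo fps_X ^ 2)" "v holomorphic_on ball 0 1" "\<And>z. \<tau> z = \<tau> 0 + z * v z"
    by (rule holomorphic_difference_quotient[OF \<tau>]) (rule that)
  have \<tau>0: "\<tau> 0 = 1" using has_fps_expansion_imp_0_eq_fps_nth_0[OF S] S0 by (simp add: \<tau>_def)
  have "inj_on (\<lambda>z. 1 / z + v z) (ball 0 1 - {0})"
  proof (rule inj_onI)
    have k: "1 / z + v z = inverse (z * s (z ^ 2))" if "z \<noteq> 0" for z
      using v(3)[of z] that unfolding \<tau>0 by (simp add: \<tau>_def field_simps)
    fix z w assume zw: "z \<in> ball 0 1 - {0}" "w \<in> ball 0 1 - {0}" "1 / z + v z = 1 / w + v w"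
    hence eq: "z * s (z ^ 2) = w * s (w ^ 2)" using k by (metis DiffD2 inverse_eq_iff_eq singletonI)
    hence "c * (z * s (z ^ 2)) ^ 2 = c * (w * s (w ^ 2)) ^ 2" by simp
    hence "\<phi> (z ^ 2) = \<phi> (w ^ 2)"
      using zw sq by (simp add: \<phi>u us power_mult_distrib mult_ac)
    hence "z ^ 2 = w ^ 2" using inj_onD[OF inj] sq zw by blast
    hence "z = w \<or> z = - w" by (simp add: power2_eq_iff)
    \<comment> \<open>The function z s(z^2) is odd and has no zero other than 0 in the disc.\<close>
    moreover have "z \<noteq> - w"
    proof
      assume "z = - w"
      with eq have "w * s (w ^ 2) = 0" by simp
      thus False using zw s_nz sq by auto
    qed
    ultimately show "z = w" by blast
  qed
  note area = area_theorem[OF v(1,2) this]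
  \<comment> \<open>The j-th coefficient of 1/s sits at index 2j - 1 of v, which is where the
    weights 2j - 1 come from.\<close>
  have nth: "fps_nth (fps_shift 1 (T oo fps_X ^ 2)) (2 * j - 1) = fps_nth T j" if "j \<ge> 1" for j
  proof -
    have "fps_nth (fps_shift 1 (T oo fps_X ^ 2)) (2 * j - 1) = fps_nth (T oo fps_X ^ 2) (2 * j)"
      using that by simp
    also have "\<dots> = (\<Sum>i=0..2 * j. if i = j then fps_nth T i else 0)"
      unfolding fps_compose_nth by (intro sum.cong) (auto simp: fps_X_power_nth simp flip: power_mult)
    also have "\<dots> = fps_nth T j" by simp
    finally show ?thesis .
  qed
  have bnd: "(\<Sum>j\<le>n. (2 * real j - 1) * (cmod (fps_nth T j))\<^sup>2) \<le> 0" for n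
  proof -
    have "(\<Sum>j\<le>n. (2 * real j - 1) * (cmod (fps_nth T j))\<^sup>2)
        = - 1 + (\<Sum>j=1..n. (2 * real j - 1) * (cmod (fps_nth T j))\<^sup>2)"
      by (simp add: atMost_atLeast0 sum.atLeast_Suc_atMost T_def S0)
    also have "(\<Sum>j=1..n. (2 * real j - 1) * (cmod (fps_nth T j))\<^sup>2)
        = (\<Sum>j=1..n. real (2 * j - 1) * (cmod (fps_nth (fps_shift 1 (T oo fps_X ^ 2)) (2 * j - 1)))\<^sup>2)"
      by (intro sum.cong refl) (auto simp only: nth atLeastAtMost_iff, simp add: of_nat_diff)
    also have "\<dots> = (\<Sum>i\<in>(\<lambda>j. 2 * j - 1) ` {1..n}. real i * (cmod (fps_nth (fps_shift 1 (T oo fps_X ^ 2)) i))\<^sup>2)"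
      by (subst sum.reindex) (auto simp: inj_on_def o_def)
    also have "\<dots> \<le> (\<Sum>i\<le>2*n. real i * (cmod (fps_nth (fps_shift 1 (T oo fps_X ^ 2)) i))\<^sup>2)"
      by (rule sum_mono2) auto
    also have "\<dots> \<le> 1" by (rule area)
    finally show ?thesis by simp
  qed
  from that[OF c0[unfolded c_def] \<Phi>[unfolded c_def] S0 bnd[unfolded T_def]] show ?thesis .
qed

section \<open>Bieberbach's second coefficient and Koebe's quarter theorem\<close>

lemma fps_mult_inverse_nth_1:
  fixes S :: "complex fps"
  assumes "fps_nth S 0 = 1"
  shows "fps_nth S 1 = - fps_nth (inverse S) 1"
proof -
  have "fps_nth (S * inverse S) 1 = 0" using assms by (simp add: inverse_mult_eq_1')
  thus ?thesis using assms by (simp add: fps_mult_nth_1 add_eq_0_iff)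
qed

lemma bieberbach_second_coeff:
  fixes \<Phi> :: "complex fps"
  assumes \<phi>: "\<phi> has_fps_expansion \<Phi>" "\<phi> holomorphic_on ball 0 1" "inj_on \<phi> (ball 0 1)" "\<phi> 0 = 0"
  shows "cmod (fps_nth \<Phi> 2) \<le> 2 * cmod (fps_nth \<Phi> 1)"
proof -
  obtain S where S: "\<Phi> = fps_const (fps_nth \<Phi> 1) * fps_X * S ^ 2" "fps_nth S 0 = 1"
    "\<And>n. (\<Sum>j\<le>n. (2 * real j - 1) * (cmod (fps_nth (inverse S) j))\<^sup>2) \<le> 0"
    using univalent_sqrt_transform[OF \<phi>] by blast
  have "(cmod (fps_nth S 1))\<^sup>2 \<le> 1\<^sup>2"
    using S(3)[of 1] S(2) unfolding fps_mult_inverse_nth_1[OF S(2)] by simp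
  hence "cmod (fps_nth S 1) \<le> 1" by (rule power2_le_imp_le) auto
  moreover have "fps_nth \<Phi> 2 = fps_nth \<Phi> 1 * (2 * fps_nth S 1)"
    by (subst S(1)) (simp add: mult.assoc fps_X_mult_nth numeral_2_eq_2 power2_eq_square fps_mult_nth_1 S(2))
  ultimately show ?thesis
    by (simp add: norm_mult mult_left_le_one_le)
qed

text \<open>For an omitted value \<zeta> the function \<phi>/(1 - \<phi>/\<zeta>) is again univalent
  with the same first coefficient c, and its second coefficient exceeds that of \<phi> by
  c^2/\<zeta>. Bieberbach's bound for both functions gives |c|^2/|\<zeta>| <= 4 |c|.\<close>

lemma koebe_quarter:
  assumes \<phi>: "\<phi> has_fps_expansion \<Phi>" "\<phi> holomorphic_on ball 0 1" "inj_on \<phi> (ball 0 1)" "\<phi> 0 = 0"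
    and \<zeta>: "\<zeta> \<notin> \<phi> ` ball 0 1"
  shows "cmod (fps_nth \<Phi> 1) \<le> 4 * cmod \<zeta>"
proof -
  have \<zeta>0: "\<zeta> \<noteq> 0" using \<zeta> \<phi>(4) by (auto intro: image_eqI[of _ _ 0])
  have ne: "1 - \<phi> z / \<zeta> \<noteq> 0" if "z \<in> ball 0 1" for z
    using \<zeta> that \<zeta>0 by auto
  define \<psi> where "\<psi> = (\<lambda>z. \<phi> z * inverse (1 - \<phi> z / \<zeta>))"
  define D where "D = 1 - \<Phi> * fps_const (1 / \<zeta>)"
  have \<Phi>0: "fps_nth \<Phi> 0 = 0"
    using has_fps_expansion_imp_0_eq_fps_nth_0[OF \<phi>(1)] \<phi>(4) by simp
  have "(\<lambda>z. 1 - \<phi> z * (1 / \<zeta>)) has_fps_expansion D"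
    unfolding D_def by (intro has_fps_expansion_diff has_fps_expansion_1 has_fps_expansion_cmult_right \<phi>)
  hence "(\<lambda>z. 1 - \<phi> z / \<zeta>) has_fps_expansion D" by simp
  hence \<psi>: "\<psi> has_fps_expansion \<Phi> * inverse D"
    unfolding \<psi>_def by (intro has_fps_expansion_mult has_fps_expansion_inverse \<phi>) (auto simp: D_def \<Phi>0)
  have h\<psi>: "\<psi> holomorphic_on ball 0 1"
    unfolding \<psi>_def by (intro holomorphic_intros \<phi> ne \<zeta>0)
  have "inj_on \<psi> (ball 0 1)"
  proof (rule inj_onI)
    fix z w :: complex assume zw: "z \<in> ball 0 1" "w \<in> ball 0 1" "\<psi> z = \<psi> w"
    hence "\<phi> z * (1 - \<phi> w / \<zeta>) = \<phi> w * (1 - \<phi> z / \<zeta>)"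
      using ne[OF zw(1)] ne[OF zw(2)] by (simp add: \<psi>_def field_simps)
    hence "\<phi> z = \<phi> w" by (simp add: algebra_simps)
    thus "z = w" using inj_onD[OF \<phi>(3)] zw by blast
  qed
  from bieberbach_second_coeff[OF \<psi> h\<psi> this]
  have *: "cmod (fps_nth (\<Phi> * inverse D) 2) \<le> 2 * cmod (fps_nth (\<Phi> * inverse D) 1)"
    by (simp add: \<psi>_def \<phi>(4))
  have D0: "fps_nth D 0 = 1" "fps_nth D 1 = - fps_nth \<Phi> 1 / \<zeta>" by (simp_all add: D_def \<Phi>0)
  have I: "fps_nth (inverse D) 0 = 1" "fps_nth (inverse D) 1 = fps_nth \<Phi> 1 / \<zeta>"
  proof -
    have "fps_nth (inverse D) 1 = - fps_nth D 1"
      by (simp only: fps_mult_inverse_nth_1[OF D0(1)] minus_minus)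
    thus "fps_nth (inverse D) 1 = fps_nth \<Phi> 1 / \<zeta>" by (simp only: D0) simp
  qed (simp add: D0)
  have "fps_nth (\<Phi> * inverse D) 1 = fps_nth \<Phi> 1"
    using I by (simp add: fps_mult_nth_1 \<Phi>0)
  moreover have "fps_nth (\<Phi> * inverse D) 2 = fps_nth \<Phi> 2 + (fps_nth \<Phi> 1)\<^sup>2 / \<zeta>"
    unfolding fps_mult_nth using I \<Phi>0 by (simp add: numeral_2_eq_2 power2_eq_square)
  ultimately have le: "cmod (fps_nth \<Phi> 2 + (fps_nth \<Phi> 1)\<^sup>2 / \<zeta>) \<le> 2 * cmod (fps_nth \<Phi> 1)"
    using * by simp
  have "cmod ((fps_nth \<Phi> 1)\<^sup>2 / \<zeta>) \<le> cmod (fps_nth \<Phi> 2 + (fps_nth \<Phi> 1)\<^sup>2 / \<zeta>) + cmod (fps_nth \<Phi> 2)"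
    by (metis add_diff_cancel_left' norm_triangle_ineq4)
  also have "\<dots> \<le> 4 * cmod (fps_nth \<Phi> 1)"
    using le bieberbach_second_coeff[OF \<phi>] by simp
  finally have "cmod (fps_nth \<Phi> 1) * cmod (fps_nth \<Phi> 1) \<le> 4 * cmod \<zeta> * cmod (fps_nth \<Phi> 1)"
    using \<zeta>0 by (simp add: norm_divide norm_mult norm_power power2_eq_square field_simps)
  moreover have "fps_nth \<Phi> 1 \<noteq> 0"
    using univalent_sqrt_transform[OF \<phi>] by blast
  ultimately show ?thesis by simp
qed

text \<open>Otherwise the inverse function would be entire and bounded, contradicting Liouville.
  This makes the frontier nonempty; \<open>infdist\<close> to the empty set is 0 by convention,
  which would ruin the quarter theorem.\<close>

lemma univalent_image_not_UNIV:
  assumes "\<phi> holomorphic_on ball 0 1" "inj_on \<phi> (ball 0 1)"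
  shows "\<phi> ` ball 0 1 \<noteq> UNIV"
proof
  assume U: "\<phi> ` ball 0 1 = UNIV"
  obtain \<gamma> where \<gamma>: "\<gamma> holomorphic_on \<phi> ` ball 0 1" "\<And>z. z \<in> ball 0 1 \<Longrightarrow> \<gamma> (\<phi> z) = z"
    by (rule holomorphic_has_inverse[OF assms(1) open_ball assms(2)]) (rule that)
  have "range \<gamma> = \<gamma> ` \<phi> ` ball 0 1" by (simp only: U)
  also have "\<dots> \<subseteq> ball 0 1" using \<gamma>(2) by auto
  finally have "bounded (range \<gamma>)" using bounded_ball bounded_subset by blast
  then have "\<gamma> constant_on UNIV" using Liouville_theorem \<gamma>(1) U by simp
  hence "\<gamma> (\<phi> 0) = \<gamma> (\<phi> (1/2))" by (auto simp: constant_on_def)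
  thus False using \<gamma>(2)[of 0] \<gamma>(2)[of "1/2"] by simp
qed

lemma koebe_quarter_infdist:
  assumes \<phi>: "\<phi> has_fps_expansion \<Phi>" "\<phi> holomorphic_on ball 0 1" "inj_on \<phi> (ball 0 1)" "\<phi> 0 = 0"
  shows "cmod (fps_nth \<Phi> 1) \<le> 4 * infdist 0 (frontier (\<phi> ` ball 0 1))"
proof -
  have "open (\<phi> ` ball 0 1)" by (rule open_mapping_thm3[OF \<phi>(2) open_ball \<phi>(3)])
  hence disj: "frontier (\<phi> ` ball 0 1) \<inter> \<phi> ` ball 0 1 = {}"
    by (auto simp: frontier_def interior_open)
  have ne: "frontier (\<phi> ` ball 0 1) \<noteq> {}"
    using univalent_image_not_UNIV[OF \<phi>(2,3)] by (auto simp: frontier_eq_empty)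
  have "cmod (fps_nth \<Phi> 1) / 4 \<le> infdist 0 (frontier (\<phi> ` ball 0 1))"
    unfolding infdist_notempty[OF ne]
  proof (rule cINF_greatest[OF ne])
    fix \<zeta> assume "\<zeta> \<in> frontier (\<phi> ` ball 0 1)"
    hence "\<zeta> \<notin> \<phi> ` ball 0 1" using disj by blast
    from koebe_quarter[OF \<phi> this] show "cmod (fps_nth \<Phi> 1) / 4 \<le> dist 0 \<zeta>" by simp
  qed
  thus ?thesis by simp
qed

section \<open>Numerical coefficient bounds for the square root s\<close>

lemma norm_fps_nth_le_inverse_recursion:
  fixes S :: "complex fps"
  assumes "fps_nth S 0 = 1"
  shows "cmod (fps_nth S (Suc n)) \<le> (\<Sum>j\<le>n. cmod (fps_nth (inverse S) (Suc j)) * cmod (fps_nth S (n - j)))"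
proof -
  have "fps_nth (inverse S * S) (Suc n) = 0" using assms by (simp add: inverse_mult_eq_1)
  hence "fps_nth S (Suc n) + (\<Sum>j\<le>n. fps_nth (inverse S) (Suc j) * fps_nth S (n - j)) = 0"
    using assms unfolding fps_mult_nth atMost_atLeast0[symmetric] sum.atMost_Suc_shift by simp
  hence "fps_nth S (Suc n) = - (\<Sum>j\<le>n. fps_nth (inverse S) (Suc j) * fps_nth S (n - j))"
    by (simp add: eq_neg_iff_add_eq_0)
  thus ?thesis
    by (simp only: norm_minus_cancel) (rule order_trans[OF norm_sum], simp add: norm_mult)
qed

text \<open>Here x, y, z stand for |t_1|, |t_2|, |t_3| and the left-hand side is what the recursion
  gives for |s_3|. Bounding the three separately would give about 2.6; under the joint constraint
  the maximum is about 1.23, so 5/4 leaves little slack.\<close>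

lemma third_coeff_polynomial:
  fixes x y z :: real
  assumes "0 \<le> x" "0 \<le> y" "0 \<le> z" "x\<^sup>2 + 3 * y\<^sup>2 + 5 * z\<^sup>2 \<le> 1"
  shows "x ^ 3 + 2 * x * y + z \<le> 5 / 4"
proof -
  have x1: "x \<le> 1"
  proof -
    have "x\<^sup>2 \<le> 1\<^sup>2" unfolding one_power2 using assms(4) zero_le_power2[of y] zero_le_power2[of z] by linarith
    thus ?thesis by (rule power2_le_imp_le) simp
  qed
  have "15 * (2 * x * y + z)\<^sup>2 = (3 * y\<^sup>2 + 5 * z\<^sup>2) * (20 * x\<^sup>2 + 3) - (3 * y - 10 * x * z)\<^sup>2"
    by (simp add: power2_eq_square algebra_simps)
  also have "\<dots> \<le> (1 - x\<^sup>2) * (20 * x\<^sup>2 + 3)"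
  proof -
    have "(3 * y\<^sup>2 + 5 * z\<^sup>2) * (20 * x\<^sup>2 + 3) \<le> (1 - x\<^sup>2) * (20 * x\<^sup>2 + 3)"
      using assms(4) by (intro mult_right_mono) auto
    thus ?thesis using zero_le_power2[of "3 * y - 10 * x * z"] by linarith
  qed
  \<comment> \<open>Cauchy-Schwarz has eliminated \<open>y\<close> and \<open>z\<close>; a sum-of-squares certificate settles the polynomial inequality in \<open>x\<close>.\<close>
  finally have "15 * (2 * x * y + z)\<^sup>2 \<le> (1 - x\<^sup>2) * (20 * x\<^sup>2 + 3)" .
  hence 1: "(2 * x * y + z)\<^sup>2 \<le> (1 - x\<^sup>2) * (4 / 3 * x\<^sup>2 + 1 / 5)"
  proof -
    have "(1 - x\<^sup>2) * (20 * x\<^sup>2 + 3) = 15 * ((1 - x\<^sup>2) * (4 / 3 * x\<^sup>2 + 1 / 5))"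
      by (simp add: field_simps)
    with \<open>15 * (2 * x * y + z)\<^sup>2 \<le> _\<close> show ?thesis by linarith
  qed
  have "(5 / 4 - x ^ 3)\<^sup>2 - (1 - x\<^sup>2) * (4 / 3 * x\<^sup>2 + 1 / 5) =
     (x ^ 3 - 13 / 20 * x - 21 / 100)\<^sup>2 + 79 / 30 * (x\<^sup>2 - 156 / 395 * x - 51 / 100)\<^sup>2
     + (341011 / 474000 * (x - 1580553 / 1705055)\<^sup>2 + 520607903 / 34101100000)"
    by (simp add: power2_eq_square power3_eq_cube field_simps)
  moreover have "\<dots> \<ge> 0" by (intro add_nonneg_nonneg mult_nonneg_nonneg) auto
  ultimately have "(2 * x * y + z)\<^sup>2 \<le> (5 / 4 - x ^ 3)\<^sup>2" using 1 by linarith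
  moreover have "x ^ 3 \<le> 1" using x1 assms(1) by (simp add: power_le_one)
  hence "0 \<le> 5 / 4 - x ^ 3" by simp
  ultimately have "2 * x * y + z \<le> 5 / 4 - x ^ 3"
    by (rule power2_le_imp_le)
  thus ?thesis by simp
qed

text \<open>For \<open>a 2\<close> and \<open>a 3\<close> the area inequality is used jointly in
  |t_1|, |t_2|, |t_3|; from \<open>a 4\<close> on only through |t_1| <= 1, |t_2| <= 1/sqrt 3 < 0.58
  and |t_j| <= 1/sqrt 5 < 0.45 for j >= 3. The constants are rounded outcomes of the recursion;
  153/1000 is fitted at n = 5, where 153/1000 * 2^5 = 612/125.\<close>

lemma sqrt_transform_coeff_bounds:
  fixes S :: "complex fps"
  assumes S0: "fps_nth S 0 = 1"
    and area: "\<And>n. (\<Sum>j\<le>n. (2 * real j - 1) * (cmod (fps_nth (inverse S) j))\<^sup>2) \<le> 0"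
  defines "a \<equiv> \<lambda>n. cmod (fps_nth S n)"
  shows "a 0 = 1" "a 1 \<le> 1" "a 2 \<le> 13 / 12" "a 3 \<le> 5 / 4" "a 4 \<le> 2779 / 1000" "a 5 \<le> 612 / 125"
    and "\<And>n. n \<ge> 5 \<Longrightarrow> a n \<le> 153 / 1000 * 2 ^ n"
proof -
  define t where "t = (\<lambda>j. cmod (fps_nth (inverse S) j))"
  have tp: "0 \<le> t j" for j by (simp add: t_def)
  have ap: "0 \<le> a j" for j by (simp add: a_def)
  have t0: "t 0 = 1" by (simp add: t_def S0)
  have rec: "a (Suc n) \<le> (\<Sum>j\<le>n. t (Suc j) * a (n - j))" for n
    unfolding a_def t_def by (rule norm_fps_nth_le_inverse_recursion[OF S0])
  show a0: "a 0 = 1" by (simp add: a_def S0)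
  have t123: "(t 1)\<^sup>2 + 3 * (t 2)\<^sup>2 + 5 * (t 3)\<^sup>2 \<le> 1"
    using area[of 3] t0 by (simp add: t_def numeral_eq_Suc)
  have tj: "(t j)\<^sup>2 \<le> 1 / (2 * real j - 1)" if "j \<ge> 1" for j
  proof -
    have "- 1 + (2 * real j - 1) * (t j)\<^sup>2 = (\<Sum>i\<in>{0, j}. (2 * real i - 1) * (t i)\<^sup>2)"
      using that by (simp add: t0)
    also have "\<dots> \<le> (\<Sum>i\<le>j. (2 * real i - 1) * (t i)\<^sup>2)"
      by (rule sum_mono2) (auto intro!: mult_nonneg_nonneg)
    also have "\<dots> \<le> 0" unfolding t_def by (rule area)
    finally show ?thesis using that by (simp add: field_simps)
  qed
  have t1: "t 1 \<le> 1"
    using tj[of 1] by (intro power2_le_imp_le[of "t 1" 1]) auto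
  have t2: "t 2 \<le> 58 / 100"
    using tj[of 2] by (intro power2_le_imp_le[of "t 2"]) (auto simp: power2_eq_square)
  have t3: "t j \<le> 45 / 100" if "j \<ge> 3" for j
  proof (rule power2_le_imp_le)
    have "(t j)\<^sup>2 \<le> 1 / (2 * real j - 1)" using that by (intro tj) auto
    also have "\<dots> \<le> 1 / 5" using that by (intro divide_left_mono) auto
    finally show "(t j)\<^sup>2 \<le> (45 / 100)\<^sup>2" by (simp add: power2_eq_square)
  qed simp
  have a1': "a 1 \<le> t 1" using rec[of 0] by (simp add: a0)
  show a1: "a 1 \<le> 1" using a1' t1 by simp
  have a2': "a 2 \<le> (t 1)\<^sup>2 + t 2"
  proof -
    have "a 2 \<le> t 1 * a 1 + t 2" using rec[of 1] by (simp add: a0 numeral_2_eq_2)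
    also have "t 1 * a 1 \<le> t 1 * t 1" by (intro mult_left_mono a1' tp)
    finally show ?thesis by (simp add: power2_eq_square)
  qed
  show a2: "a 2 \<le> 13 / 12"
  proof -
    \<comment> \<open>Since t_1^2 <= 1 - 3 t_2^2, the bound is at most 1 - 3 t_2^2 + t_2, which is
      largest at t_2 = 1/6.\<close>
    have "0 \<le> 3 * (t 2 - 1 / 6)\<^sup>2" by simp
    also have "\<dots> = 3 * (t 2)\<^sup>2 - t 2 + 1 / 12" by (simp add: power2_eq_square algebra_simps)
    finally show ?thesis using a2' t123 zero_le_power2[of "t 3"] by linarith
  qed
  show a3: "a 3 \<le> 5 / 4"
  proof -
    have "a 3 \<le> t 1 * a 2 + t 2 * a 1 + t 3" using rec[of 2] by (simp add: a0 numeral_eq_Suc)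
    also have "t 1 * a 2 \<le> t 1 * ((t 1)\<^sup>2 + t 2)" by (intro mult_left_mono a2' tp)
    also have "t 2 * a 1 \<le> t 2 * t 1" by (intro mult_left_mono a1' tp)
    also have "t 1 * ((t 1)\<^sup>2 + t 2) + t 2 * t 1 + t 3 = t 1 ^ 3 + 2 * t 1 * t 2 + t 3"
      by (simp add: power2_eq_square power3_eq_cube algebra_simps)
    also have "\<dots> \<le> 5 / 4" by (rule third_coeff_polynomial[OF tp tp tp t123])
    finally show ?thesis by simp
  qed
  have mm: "t i * a j \<le> p * x" if "t i \<le> p" "a j \<le> x" for i j p x
    using that tp[of i] ap[of j] by (intro mult_mono) (auto intro: order_trans)
  show a4: "a 4 \<le> 2779 / 1000"
  proof -
    have "a 4 \<le> t 1 * a 3 + t 2 * a 2 + t 3 * a 1 + t 4 * a 0" using rec[of 3] by (simp add: numeral_eq_Suc)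
    with mm[OF t1 a3] mm[OF t2 a2] mm[OF t3[of 3] a1] mm[OF t3[of 4] order_refl[of "a 0"]] a0 show ?thesis by simp
  qed
  show a5: "a 5 \<le> 612 / 125"
  proof -
    have "a 5 \<le> t 1 * a 4 + t 2 * a 3 + t 3 * a 2 + t 4 * a 1 + t 5 * a 0" using rec[of 4] by (simp add: numeral_eq_Suc)
    with mm[OF t1 a4] mm[OF t2 a3] mm[OF t3[of 3] a2] mm[OF t3[of 4] a1] mm[OF t3[of 5] order_refl[of "a 0"]] a0
    show ?thesis by simp
  qed
  \<comment> \<open>A second base case: the induction needs the exponential bound at n - 1 and n -
    2, both at least 5.\<close>
  have a6: "a 6 \<le> 153 / 1000 * 2 ^ 6"
  proof -
    have "a 6 \<le> t 1 * a 5 + t 2 * a 4 + t 3 * a 3 + t 4 * a 2 + t 5 * a 1 + t 6 * a 0" using rec[of 5] by (simp add: numeral_eq_Suc)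
    with mm[OF t1 a5] mm[OF t2 a4] mm[OF t3[of 3] a3] mm[OF t3[of 4] a2] mm[OF t3[of 5] a1] mm[OF t3[of 6] order_refl[of "a 0"]] a0
    show ?thesis by simp
  qed
  show "a n \<le> 153 / 1000 * 2 ^ n" if "n \<ge> 5" for n
    using that
  proof (induction n rule: less_induct)
    case (less n)
    consider "n = 5" | "n = 6" | "n \<ge> 7" using less.prems by linarith
    thus ?case
    proof cases
      case 3
      define m where "m = n - 3"
      have m: "n = Suc (Suc (Suc m))" "m \<ge> 4" using 3 by (auto simp: m_def)
      \<comment> \<open>306/1000 is twice 153/1000, from summing powers of 2; 23/10 makes up for the
        first five terms at k = 4.\<close>
      have B: "(\<Sum>i\<le>k. a i) \<le> 306 / 1000 * 2 ^ k + 23 / 10" if "4 \<le> k" "k < n" for k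
        using that
      proof (induction k rule: dec_induct)
        case base
        have "(\<Sum>i\<le>4. a i) = a 0 + a 1 + a 2 + a 3 + a 4" by (simp add: numeral_eq_Suc)
        thus ?case using a0 a1 a2 a3 a4 by simp
      next
        case (step k)
        have "a (Suc k) \<le> 153 / 1000 * 2 ^ Suc k" using step by (intro less.IH) auto
        thus ?case using step by simp
      qed
      have "a n \<le> t 1 * a (Suc (Suc m)) + t 2 * a (Suc m) + (\<Sum>j\<le>m. t (Suc (Suc (Suc j))) * a (m - j))"
        using rec[of "Suc (Suc m)"] unfolding m(1) sum.atMost_Suc_shift by (simp add: numeral_2_eq_2)
      also have "t 1 * a (Suc (Suc m)) \<le> 1 * (153 / 1000 * 2 ^ Suc (Suc m))"
        by (rule mm[OF t1 less.IH]) (use m in auto)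
      also have "t 2 * a (Suc m) \<le> 58 / 100 * (153 / 1000 * 2 ^ Suc m)"
        by (rule mm[OF t2 less.IH]) (use m in auto)
      also have "(\<Sum>j\<le>m. t (Suc (Suc (Suc j))) * a (m - j)) \<le> (\<Sum>j\<le>m. 45 / 100 * a (m - j))"
        by (intro sum_mono mult_right_mono t3 ap) auto
      also have "\<dots> = 45 / 100 * (\<Sum>j\<le>m. a (m - j))" by (simp add: sum_distrib_left)
      also have "(\<Sum>j\<le>m. a (m - j)) = (\<Sum>j\<le>m. a j)"
        using sum.nat_diff_reindex[of a "Suc m"] by (simp add: lessThan_Suc_atMost)
      also have "\<dots> \<le> 306 / 1000 * 2 ^ m + 23 / 10" using m by (intro B) auto
      finally have "a n \<le> 1 * (153 / 1000 * 2 ^ Suc (Suc m)) + 58 / 100 * (153 / 1000 * 2 ^ Suc m) + 45 / 100 * (306 / 1000 * 2 ^ m + 23 / 10)"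
        by simp
      moreover have "(16::real) \<le> 2 ^ m" using power_increasing[of 4 m "2::real"] m by simp
      ultimately show ?thesis unfolding m(1) power_Suc by argo
    qed (use a5 a6 in simp_all)
  qed
qed

text \<open>Robertson's inequality would give \<open>q n <= n\<close>; here this is reached for n =
  1, 2. The next three constants add up rounded squares, and 89/10000 is fitted at n = 6. After that
  each step adds at most 0.0235 * 4^n, while 3 * 0.0089 * 4^n is allowed.\<close>

lemma sqrt_transform_sum_bounds:
  fixes S :: "complex fps"
  assumes S0: "fps_nth S 0 = 1"
    and area: "\<And>n. (\<Sum>j\<le>n. (2 * real j - 1) * (cmod (fps_nth (inverse S) j))\<^sup>2) \<le> 0"
  defines "q \<equiv> \<lambda>n. \<Sum>k<n. (cmod (fps_nth S k))\<^sup>2"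
  shows "q 1 \<le> 1" "q 2 \<le> 2" "q 3 \<le> 3174 / 1000" "q 4 \<le> 4737 / 1000" "q 5 \<le> 12460 / 1000"
    and "\<And>n. n \<ge> 6 \<Longrightarrow> q n \<le> 89 / 10000 * 4 ^ n"
proof -
  define a where "a = (\<lambda>n. cmod (fps_nth S n))"
  have aeq: "a n = cmod (fps_nth S n)" for n by (simp add: a_def)
  note ab = sqrt_transform_coeff_bounds[OF S0 area, folded aeq]
  have q: "q n = (\<Sum>k<n. (a k)\<^sup>2)" for n by (simp add: q_def a_def)
  have ap: "0 \<le> a j" for j by (simp add: a_def)
  have sq: "(a k)\<^sup>2 \<le> x\<^sup>2" if "a k \<le> x" for k x using that ap by (intro power_mono)
  show q1: "q 1 \<le> 1" using ab(1) by (simp add: q)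
  show q2: "q 2 \<le> 2" using q1 sq[OF ab(2)] by (simp add: q numeral_eq_Suc)
  show q3: "q 3 \<le> 3174 / 1000" using q2 sq[OF ab(3)] by (simp add: q numeral_eq_Suc power2_eq_square)
  show q4: "q 4 \<le> 4737 / 1000" using q3 sq[OF ab(4)] by (simp add: q numeral_eq_Suc power2_eq_square)
  show q5: "q 5 \<le> 12460 / 1000" using q4 sq[OF ab(5)] by (simp add: q numeral_eq_Suc power2_eq_square)
  show "q n \<le> 89 / 10000 * 4 ^ n" if "n \<ge> 6" for n
    using that
  proof (induction n rule: dec_induct)
    case base
    show ?case using q5 sq[OF ab(6)] by (simp add: q numeral_eq_Suc power2_eq_square)
  next
    case (step n)
    have "(a n)\<^sup>2 \<le> (153 / 1000 * 2 ^ n)\<^sup>2" using step by (intro sq ab(7)) auto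
    also have "\<dots> = 23409 / 1000000 * 4 ^ n"
      by (simp add: power2_eq_square flip: power_mult_distrib)
    finally have "(a n)\<^sup>2 \<le> 23409 / 1000000 * 4 ^ n" .
    moreover have "q n \<le> 89 / 10000 * 4 ^ n" by (rule step.IH)
    moreover have "q (Suc n) = q n + (a n)\<^sup>2" by (simp add: q)
    moreover have "(4 :: real) ^ Suc n = 4 * 4 ^ n" "(0 :: real) \<le> 4 ^ n" by simp_all
    ultimately show ?case by argo
  qed
qed

text \<open>The second part of the weight is the worst-case share of the b-sum per unit of |a_n|.
  Everything is evaluated at the endpoint 797/5000, where 4r < 0.64 keeps the tail geometric; the
  total is about 0.2495.\<close>

lemma weighted_sum_bound:
  fixes q :: "nat \<Rightarrow> real" and r :: real
  assumes q: "q 1 \<le> 1" "q 2 \<le> 2" "q 3 \<le> 3174 / 1000" "q 4 \<le> 4737 / 1000" "q 5 \<le> 12460 / 1000"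
    "\<And>n. n \<ge> 6 \<Longrightarrow> q n \<le> 89 / 10000 * 4 ^ n"
    and q0: "\<And>n. 0 \<le> q n"
    and r: "0 \<le> r" "r \<le> 797 / 5000"
  shows "(\<Sum>n=1..N. q n * (r ^ n + real n / (real n + 1) * r ^ (n + 1))) \<le> 1 / 4"
proof -
  define \<rho> where "\<rho> = (797 / 5000 :: real)"
  define w where "w = (\<lambda>x n. x ^ n + real n / (real n + 1) * x ^ (n + 1) :: real)"
  have w0: "0 \<le> w x n" if "0 \<le> x" for x n using that by (simp add: w_def)
  have w_mono: "w r n \<le> w \<rho> n" for n
    using r unfolding w_def \<rho>_def by (intro add_mono mult_left_mono power_mono) auto
  have \<rho>0: "0 \<le> \<rho>" by (simp add: \<rho>_def)
  have "(\<Sum>n=1..N. q n * w r n) \<le> (\<Sum>n=1..N. q n * w \<rho> n)"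
    by (intro sum_mono mult_left_mono w_mono q0)
  \<comment> \<open>Enlarging the range guarantees that the five explicit terms are present for
    every N.\<close>
  also have "\<dots> \<le> (\<Sum>n=1..5 + N. q n * w \<rho> n)"
    by (rule sum_mono2) (auto intro!: mult_nonneg_nonneg q0 w0 \<rho>0)
  also have "\<dots> = (\<Sum>n=1..5. q n * w \<rho> n) + (\<Sum>n=6..5 + N. q n * w \<rho> n)"
    using sum.ub_add_nat[of 1 5 "\<lambda>n. q n * w \<rho> n" N] by simp
  also have "(\<Sum>n=1..5. q n * w \<rho> n) = q 1 * w \<rho> 1 + q 2 * w \<rho> 2 + q 3 * w \<rho> 3 + q 4 * w \<rho> 4 + q 5 * w \<rho> 5"
    by (simp add: numeral_eq_Suc)
  also have "\<dots> \<le> 1 * w \<rho> 1 + 2 * w \<rho> 2 + 3174 / 1000 * w \<rho> 3 + 4737 / 1000 * w \<rho> 4 + 12460 / 1000 * w \<rho> 5"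
    by (intro add_mono mult_right_mono q w0 \<rho>0)
  also have "(\<Sum>n=6..5 + N. q n * w \<rho> n) \<le> (\<Sum>n=6..5 + N. 89 / 10000 * (1 + \<rho>) * (4 * \<rho>) ^ n)"
  proof (rule sum_mono)
    fix n assume n: "n \<in> {6..5 + N}"
    have "w \<rho> n \<le> \<rho> ^ n + 1 * \<rho> ^ (n + 1)"
      unfolding w_def using \<rho>0 by (intro add_mono mult_right_mono) auto
    hence "q n * w \<rho> n \<le> 89 / 10000 * 4 ^ n * (\<rho> ^ n + 1 * \<rho> ^ (n + 1))"
      using n by (intro mult_mono q w0 \<rho>0) auto
    thus "q n * w \<rho> n \<le> 89 / 10000 * (1 + \<rho>) * (4 * \<rho>) ^ n"
      by (simp add: power_mult_distrib algebra_simps)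
  qed
  also have "\<dots> = 89 / 10000 * (1 + \<rho>) * (\<Sum>n=6..5 + N. (4 * \<rho>) ^ n)"
    by (simp add: sum_distrib_left)
  also have "(\<Sum>n=6..5 + N. (4 * \<rho>) ^ n) \<le> (4 * \<rho>) ^ 6 / (1 - 4 * \<rho>)"
    by (subst sum_gp) (auto simp: \<rho>_def intro!: divide_right_mono)
  finally have "(\<Sum>n=1..N. q n * w r n) \<le> 1 * w \<rho> 1 + 2 * w \<rho> 2 + 3174 / 1000 * w \<rho> 3 + 4737 / 1000 * w \<rho> 4 + 12460 / 1000 * w \<rho> 5
     + 89 / 10000 * (1 + \<rho>) * ((4 * \<rho>) ^ 6 / (1 - 4 * \<rho>))"
    using \<rho>0 by (simp add: mult_left_mono)
  also have "\<dots> \<le> 1 / 4"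
    by (simp add: w_def \<rho>_def power_divide eval_nat_numeral)
  finally show ?thesis by (simp add: w_def)
qed

text \<open>With P = S o W and W = X V one gets H = c X (V P) P. Splitting each product of the
  convolution by 2xy <= x^2 + y^2 leaves the square sums of V P and of P, both bounded by that of
  S.\<close>

lemma subordinate_coeff_bound:
  fixes H S W :: "complex fps"
  assumes w: "w has_fps_expansion W" "w holomorphic_on ball 0 1" "\<And>z. cmod z < 1 \<Longrightarrow> cmod (w z) \<le> cmod z"
    and H: "H = (fps_const c * fps_X * S ^ 2) oo W"
  shows "cmod (fps_nth H (Suc n)) \<le> cmod c * (\<Sum>k\<le>n. (cmod (fps_nth S k))\<^sup>2)"
proof -
  obtain v V where v: "v has_fps_expansion V" "v holomorphic_on ball 0 1" "\<And>z. cmod z < 1 \<Longrightarrow> cmod (v z) \<le> 1"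
    and W: "W = fps_X * V"
    using schwarz_factor[OF w] by metis
  have W0: "fps_nth W 0 = 0" by (simp add: W)
  define P where "P = S oo W"
  have "H = fps_const c * W * P ^ 2"
    unfolding H P_def power2_eq_square
    by (simp add: fps_compose_mult_distrib[OF W0] fps_X_fps_compose_startby0 W0)
  also have "\<dots> = fps_const c * (fps_X * ((V * P) * P))"
    by (simp add: W power2_eq_square mult_ac)
  finally have "fps_nth H (Suc n) = c * fps_nth ((V * P) * P) n" by simp
  hence "cmod (fps_nth H (Suc n)) = cmod c * cmod (\<Sum>i\<le>n. fps_nth (V * P) i * fps_nth P (n - i))"
    by (simp add: norm_mult fps_mult_nth atMost_atLeast0)
  also have "cmod (\<Sum>i\<le>n. fps_nth (V * P) i * fps_nth P (n - i)) \<le> (\<Sum>i\<le>n. cmod (fps_nth (V * P) i) * cmod (fps_nth P (n - i)))"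
    by (rule order_trans[OF norm_sum]) (simp add: norm_mult)
  also have "\<dots> \<le> (\<Sum>i\<le>n. ((cmod (fps_nth (V * P) i))\<^sup>2 + (cmod (fps_nth P (n - i)))\<^sup>2) / 2)"
  proof (rule sum_mono)
    fix i
    show "cmod (fps_nth (V * P) i) * cmod (fps_nth P (n - i)) \<le> ((cmod (fps_nth (V * P) i))\<^sup>2 + (cmod (fps_nth P (n - i)))\<^sup>2) / 2"
      using sum_squares_bound[of "cmod (fps_nth (V * P) i)" "cmod (fps_nth P (n - i))"] by simp
  qed
  also have "\<dots> = ((\<Sum>i\<le>n. (cmod (fps_nth (V * P) i))\<^sup>2) + (\<Sum>i\<le>n. (cmod (fps_nth P (n - i)))\<^sup>2)) / 2"
    by (simp add: sum.distrib sum_divide_distrib[symmetric])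
  also have "(\<Sum>i\<le>n. (cmod (fps_nth P (n - i)))\<^sup>2) = (\<Sum>i\<le>n. (cmod (fps_nth P i))\<^sup>2)"
    using sum.nat_diff_reindex[of "\<lambda>i. (cmod (fps_nth P i))\<^sup>2" "Suc n"] by (simp add: lessThan_Suc_atMost)
  also have "((\<Sum>i\<le>n. (cmod (fps_nth (V * P) i))\<^sup>2) + (\<Sum>i\<le>n. (cmod (fps_nth P i))\<^sup>2)) / 2
      \<le> (\<Sum>i\<le>n. (cmod (fps_nth S i))\<^sup>2)"
    using schur_multiplier_l2[OF v, of P n] rogosinski_l2[OF w, of S n] by (simp add: P_def)
  finally show ?thesis by (simp add: mult_left_mono)
qed

section \<open>The majorant series\<close>

lemma has_fps_expansion_of_sums:
  fixes c :: "nat \<Rightarrow> complex"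
  assumes "\<And>z. z \<in> ball 0 1 \<Longrightarrow> (\<lambda>n. c n * z ^ n) sums f z"
  shows "f has_fps_expansion Abs_fps c"
proof -
  have "summable (\<lambda>n. c n * (1/2) ^ n)"
    using assms[of "1/2"] by (simp add: sums_iff)
  hence "conv_radius c \<ge> norm (1/2 :: complex)" by (rule conv_radius_geI)
  hence "fps_conv_radius (Abs_fps c) > 0"
    by (simp add: fps_conv_radius_def Abs_fps_inverse) (metis ereal_less(2) half_gt_zero_iff less_le_trans zero_less_one)
  moreover have "\<forall>\<^sub>F z in nhds 0. eval_fps (Abs_fps c) z = f z"
    using eventually_nhds_in_open[of "ball 0 1" "0::complex"]
    by (auto elim!: eventually_mono simp: eval_fps_def sums_unique[OF assms, symmetric])
  ultimately show ?thesis by (simp add: has_fps_expansion_def)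
qed

text \<open>The Omega of the overview is \<open>v\<close> here; \<open>\<Omega>\<close> is the
  series of the dilatation itself. From g' = z v h' each coefficient of g is a convolution, the sum
  over a triangle of indices is enlarged to a square, and there the factor belonging to
  \<open>v\<close> is at most 1 by Bohr's inequality.\<close>

lemma dilatation_coeff_sum:
  fixes H G :: "complex fps"
  assumes h: "h has_fps_expansion H" "h holomorphic_on ball 0 1"
    and g: "g has_fps_expansion G" "g holomorphic_on ball 0 1"
    and sp: "\<And>z. z \<in> ball 0 1 \<Longrightarrow> cmod (deriv g z) < cmod (deriv h z)"
    and G1: "fps_nth G 1 = 0"
    and r: "0 \<le> r" "r \<le> 1 / 3"
  shows "(\<Sum>n\<le>N. cmod (fps_nth G (n + 2)) * r ^ (n + 2))
    \<le> (\<Sum>n\<le>N. cmod (fps_nth H (n + 1)) * (real (n + 1) / real (n + 2) * r ^ (n + 2)))"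
proof -
  define \<omega> where "\<omega> = (\<lambda>z. deriv g z / deriv h z)"
  have h'0: "deriv h z \<noteq> 0" if "z \<in> ball 0 1" for z using sp[OF that] by auto
  have dh: "deriv h holomorphic_on ball 0 1" "deriv g holomorphic_on ball 0 1"
    using h(2) g(2) by (auto intro!: holomorphic_deriv)
  have h\<omega>: "\<omega> holomorphic_on ball 0 1"
    unfolding \<omega>_def by (intro holomorphic_intros dh h'0)
  define \<Omega> where "\<Omega> = fps_expansion \<omega> 0"
  have \<Omega>: "\<omega> has_fps_expansion \<Omega>"
    unfolding \<Omega>_def by (rule has_fps_expansion_fps_expansion[OF _ _ h\<omega>]) auto
  have "deriv g 0 = 0"
    using has_fps_expansion_imp_0_eq_fps_nth_0[OF has_fps_expansion_deriv[OF g(1)]] G1 by simp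
  hence \<omega>0: "\<omega> 0 = 0" by (simp add: \<omega>_def)
  have \<omega>1: "cmod (\<omega> z) < 1" if "cmod z < 1" for z
    using sp[of z] h'0[of z] that by (simp add: \<omega>_def norm_divide)
  have "cmod (\<omega> z) \<le> cmod z" if "cmod z < 1" for z
    by (rule Schwarz_Lemma(1)[OF h\<omega> \<omega>0 \<omega>1 that])
  then obtain v V where v: "v has_fps_expansion V" "v holomorphic_on ball 0 1" "\<And>z. cmod z < 1 \<Longrightarrow> cmod (v z) \<le> 1"
    and V: "\<Omega> = fps_X * V"
    using schwarz_factor[OF \<Omega> h\<omega>] by metis
  have "(\<lambda>z. \<omega> z * deriv h z) has_fps_expansion \<Omega> * fps_deriv H"
    by (intro has_fps_expansion_mult has_fps_expansion_deriv \<Omega> h)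
  moreover have "\<forall>\<^sub>F z in nhds 0. \<omega> z * deriv h z = deriv g z"
    using eventually_nhds_in_open[of "ball 0 1" "0::complex"] h'0 by (auto elim!: eventually_mono simp: \<omega>_def)
  ultimately have "deriv g has_fps_expansion \<Omega> * fps_deriv H"
    using has_fps_expansion_cong[of "\<lambda>z. \<omega> z * deriv h z" "deriv g"] by blast
  hence "fps_deriv G = fps_X * (V * fps_deriv H)"
    using fps_expansion_unique_complex has_fps_expansion_deriv[OF g(1)] V by (metis mult.assoc)
  hence nth: "of_nat (n + 2) * fps_nth G (n + 2) = (\<Sum>i\<le>n. fps_nth V i * (of_nat (n - i + 1) * fps_nth H (n - i + 1)))" for n
  proof -
    assume "fps_deriv G = fps_X * (V * fps_deriv H)"
    hence "fps_nth (fps_deriv G) (Suc n) = fps_nth (V * fps_deriv H) n" by simp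
    thus ?thesis by (simp add: fps_mult_nth atMost_atLeast0)
  qed
  define e where "e = (\<lambda>m. cmod (fps_nth H (m + 1)) * (real (m + 1) / real (m + 2) * r ^ (m + 2)))"
  have e0: "0 \<le> e m" for m using r by (simp add: e_def)
  define k where "k = (\<lambda>i. cmod (fps_nth V i) * r ^ i)"
  have k0: "0 \<le> k i" for i using r by (simp add: k_def)
  have "cmod (fps_nth G (n + 2)) * r ^ (n + 2) \<le> (\<Sum>i\<le>n. k i * e (n - i))" for n
  proof -
    have "real (n + 2) * cmod (fps_nth G (n + 2)) = cmod (of_nat (n + 2) * fps_nth G (n + 2))"
      by (simp only: norm_mult norm_of_nat)
    also have "\<dots> \<le> (\<Sum>i\<le>n. cmod (fps_nth V i) * (real (n - i + 1) * cmod (fps_nth H (n - i + 1))))"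
      unfolding nth by (rule order_trans[OF norm_sum]) (simp only: norm_mult norm_of_nat order_refl)
    finally have "cmod (fps_nth G (n + 2)) \<le> (\<Sum>i\<le>n. cmod (fps_nth V i) * (real (n - i + 1) * cmod (fps_nth H (n - i + 1)))) / real (n + 2)"
      by (simp add: field_simps)
    hence "cmod (fps_nth G (n + 2)) * r ^ (n + 2) \<le> (\<Sum>i\<le>n. cmod (fps_nth V i) * (real (n - i + 1) * cmod (fps_nth H (n - i + 1)))) / real (n + 2) * r ^ (n + 2)"
      using r by (intro mult_right_mono) auto
    also have "\<dots> = (\<Sum>i\<le>n. cmod (fps_nth V i) * (real (n - i + 1) * cmod (fps_nth H (n - i + 1)) * r ^ (n + 2)) / real (n + 2))"
      unfolding sum_divide_distrib sum_distrib_right by (intro sum.cong refl) simp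
    also have "\<dots> \<le> (\<Sum>i\<le>n. k i * e (n - i))"
    proof (rule sum_mono)
      fix i assume i: "i \<in> {..n}"
      have "k i * e (n - i) = cmod (fps_nth V i) * (real (n - i + 1) * cmod (fps_nth H (n - i + 1)) * (r ^ i * r ^ (n - i + 2))) / real (n - i + 2)"
        by (simp add: k_def e_def)
      also have "r ^ i * r ^ (n - i + 2) = r ^ (n + 2)" using i by (simp flip: power_add)
      finally have "k i * e (n - i) = cmod (fps_nth V i) * (real (n - i + 1) * cmod (fps_nth H (n - i + 1)) * r ^ (n + 2)) / real (n - i + 2)" .
      \<comment> \<open>Replacing 1/(n + 2) by 1/(n - i + 2) turns the summand into a product of a
        function of i and one of n - i. Nothing is lost for i = 0, hence nothing for constant
        \<open>v\<close>.\<close>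
      moreover have "cmod (fps_nth V i) * (real (n - i + 1) * cmod (fps_nth H (n - i + 1)) * r ^ (n + 2)) / real (n + 2) \<le> \<dots>"
        using r by (intro divide_left_mono mult_nonneg_nonneg) auto
      ultimately show "cmod (fps_nth V i) * (real (n - i + 1) * cmod (fps_nth H (n - i + 1)) * r ^ (n + 2)) / real (n + 2) \<le> k i * e (n - i)"
        by simp
    qed
    finally show ?thesis .
  qed
  hence "(\<Sum>n\<le>N. cmod (fps_nth G (n + 2)) * r ^ (n + 2)) \<le> (\<Sum>n\<le>N. \<Sum>i\<le>n. k i * e (n - i))"
    by (rule sum_mono)
  also have "\<dots> = (\<Sum>(i, j)\<in>{(i, j). i + j \<le> N}. k i * e j)"
    by (rule sum.triangle_reindex_eq[symmetric])
  also have "\<dots> \<le> (\<Sum>(i, j)\<in>{..N} \<times> {..N}. k i * e j)"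
    by (rule sum_mono2) (auto intro: mult_nonneg_nonneg k0 e0)
  also have "\<dots> = (\<Sum>i\<le>N. k i) * (\<Sum>j\<le>N. e j)"
    by (simp add: sum_product sum.cartesian_product)
  also have "\<dots> \<le> 1 * (\<Sum>j\<le>N. e j)"
    unfolding k_def by (intro mult_right_mono bohr_inequality[OF v r] sum_nonneg e0)
  finally show ?thesis by (simp add: e_def)
qed

text \<open>The radius \<open>797 / 5000 = 0.1594\<close> lies slightly above \<open>r\<^sub>s = 0.15928\<dots>\<close>.\<close>

lemma majorant_le_infdist:
  assumes adm: "admissible f h g a b \<phi>" and r: "0 \<le> r" "r \<le> 797 / 5000"
  shows "majorant a b r \<le> infdist 0 (frontier (\<phi> ` \<D>))"
proof -
  have sp: "sense_preserving_harmonic f h g"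
    and hs: "\<And>z. z \<in> \<D> \<Longrightarrow> (\<lambda>n. a (n + 1) * z ^ (n + 1)) sums h z"
    and gs: "\<And>z. z \<in> \<D> \<Longrightarrow> (\<lambda>n. b (n + 2) * z ^ (n + 2)) sums g z"
    and sub: "subordinate h \<phi>" and \<phi>: "\<phi> holomorphic_on \<D>" "inj_on \<phi> \<D>"
    using adm by (auto simp: admissible_def)
  have hg: "h holomorphic_on \<D>" "g holomorphic_on \<D>"
    and dil: "\<And>z. z \<in> \<D> \<Longrightarrow> cmod (deriv g z) < cmod (deriv h z)"
    using sp by (auto simp: sense_preserving_harmonic_def intro: power2_less_imp_less)
  obtain w where w: "w holomorphic_on \<D>" "\<And>z. z \<in> \<D> \<Longrightarrow> cmod (w z) \<le> cmod z" "\<And>z. z \<in> \<D> \<Longrightarrow> h z = \<phi> (w z)"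
    and h\<phi>0: "h 0 = \<phi> 0"
    using sub by (auto simp: subordinate_def)
  \<comment> \<open>The values \<open>a 0\<close>, \<open>b 0\<close> and \<open>b 1\<close> do not
    enter the given series and may be arbitrary, so the formal series put 0 there.\<close>
  define H where "H = Abs_fps (\<lambda>n. if n = 0 then 0 else a n)"
  define G where "G = Abs_fps (\<lambda>n. if n < 2 then 0 else b n)"
  have H: "h has_fps_expansion H"
    unfolding H_def
  proof (rule has_fps_expansion_of_sums)
    fix z :: complex assume "z \<in> \<D>"
    thus "(\<lambda>n. (if n = 0 then 0 else a n) * z ^ n) sums h z"
      using sums_Suc[of "\<lambda>n. (if n = 0 then 0 else a n) * z ^ n" "h z"] hs[of z] by simp
  qed
  have G: "g has_fps_expansion G"
    unfolding G_def
  proof (rule has_fps_expansion_of_sums)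
    fix z :: complex assume "z \<in> \<D>"
    thus "(\<lambda>n. (if n < 2 then 0 else b n) * z ^ n) sums g z"
      using sums_iff_shift[of "\<lambda>n. (if n < 2 then 0 else b n) * z ^ n" 2 "g z"] gs[of z]
      by (simp add: lessThan_Suc numeral_2_eq_2)
  qed
  have h0: "h 0 = 0" using has_fps_expansion_imp_0_eq_fps_nth_0[OF H] by (simp add: H_def)
  define \<Phi> where "\<Phi> = fps_expansion \<phi> 0"
  have \<Phi>: "\<phi> has_fps_expansion \<Phi>"
    unfolding \<Phi>_def by (rule has_fps_expansion_fps_expansion[OF _ _ \<phi>(1)]) auto
  define W where "W = fps_expansion w 0"
  have W: "w has_fps_expansion W"
    unfolding W_def by (rule has_fps_expansion_fps_expansion[OF _ _ w(1)]) auto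
  have \<phi>0: "\<phi> 0 = 0" using h\<phi>0 h0 by simp
  define c where "c = fps_nth \<Phi> 1"
  obtain S where S: "\<Phi> = fps_const c * fps_X * S ^ 2" "fps_nth S 0 = 1"
    "\<And>n. (\<Sum>j\<le>n. (2 * real j - 1) * (cmod (fps_nth (inverse S) j))\<^sup>2) \<le> 0"
    by (rule univalent_sqrt_transform[OF \<Phi> \<phi> \<phi>0, folded c_def]) (rule that)
  have "fps_nth W 0 = 0"
    using has_fps_expansion_imp_0_eq_fps_nth_0[OF W] w(2)[of 0] by simp
  from has_fps_expansion_compose[OF \<Phi> W this] have "(\<lambda>z. \<phi> (w z)) has_fps_expansion (\<Phi> oo W)"
    by (simp add: o_def)
  moreover have "\<forall>\<^sub>F z in nhds 0. \<phi> (w z) = h z"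
    using eventually_nhds_in_open[of "ball 0 1" "0::complex"] w(3) by (auto elim!: eventually_mono)
  ultimately have "h has_fps_expansion (\<Phi> oo W)"
    using has_fps_expansion_cong[of "\<lambda>z. \<phi> (w z)" h] by blast
  hence "H = \<Phi> oo W" using fps_expansion_unique_complex H by blast
  hence HW: "H = (fps_const c * fps_X * S ^ 2) oo W" by (simp only: S(1)[symmetric])
  define q where "q = (\<lambda>n. \<Sum>k<n. (cmod (fps_nth S k))\<^sup>2)"
  have qeq: "q n = (\<Sum>k<n. (cmod (fps_nth S k))\<^sup>2)" for n by (simp add: q_def)
  note qb = sqrt_transform_sum_bounds[OF S(2,3), folded qeq]
  have an: "cmod (a (n + 1)) \<le> cmod c * q (n + 1)" for n
    using subordinate_coeff_bound[OF W w(1) _ HW, of n] w(2)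
    by (simp add: H_def q_def lessThan_Suc_atMost)
  define A where "A = (\<lambda>n. cmod (a (n + 1)) * r ^ (n + 1))"
  define B where "B = (\<lambda>n. cmod (b (n + 2)) * r ^ (n + 2))"
  have A0: "0 \<le> A n" and B0: "0 \<le> B n" for n using r by (simp_all add: A_def B_def)
  have AB: "(\<Sum>n\<le>N. A n) + (\<Sum>n\<le>N. B n) \<le> cmod c / 4" for N
  proof -
    have "(\<Sum>n\<le>N. B n) \<le> (\<Sum>n\<le>N. cmod (a (n + 1)) * (real (n + 1) / real (n + 2) * r ^ (n + 2)))"
      using dilatation_coeff_sum[OF H hg(1) G hg(2) dil, of r N] r by (simp add: B_def G_def H_def)
    hence "(\<Sum>n\<le>N. A n) + (\<Sum>n\<le>N. B n)
        \<le> (\<Sum>n\<le>N. cmod (a (n + 1)) * (r ^ (n + 1) + real (n + 1) / real (n + 2) * r ^ (n + 2)))"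
      by (simp add: A_def sum.distrib distrib_left)
    also have "\<dots> \<le> (\<Sum>n\<le>N. cmod c * q (n + 1) * (r ^ (n + 1) + real (n + 1) / real (n + 2) * r ^ (n + 2)))"
      using r by (intro sum_mono mult_right_mono an) auto
    also have "\<dots> = cmod c * (\<Sum>n\<le>N. q (n + 1) * (r ^ (n + 1) + real (n + 1) / (real (n + 1) + 1) * r ^ (n + 1 + 1)))"
      by (simp add: sum_distrib_left mult.assoc add.commute)
    also have "(\<Sum>n\<le>N. q (n + 1) * (r ^ (n + 1) + real (n + 1) / (real (n + 1) + 1) * r ^ (n + 1 + 1)))
       = (\<Sum>n=1..Suc N. q n * (r ^ n + real n / (real n + 1) * r ^ (n + 1)))"
      using sum.shift_bounds_cl_Suc_ivl[of "\<lambda>n. q n * (r ^ n + real n / (real n + 1) * r ^ (n + 1))" 0 N]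
      by (simp add: atMost_atLeast0)
    also have "\<dots> \<le> 1 / 4"
      by (rule weighted_sum_bound[OF qb _ r]) (auto simp: qeq intro: sum_nonneg)
    finally show ?thesis by (simp add: mult_left_mono)
  qed
  have AB': "(\<Sum>n<N. A n) + (\<Sum>n<N. B n) \<le> cmod c / 4" for N
  proof (cases N)
    case (Suc M)
    then show ?thesis using AB[of M] by (simp only: lessThan_Suc_atMost)
  qed simp
  \<comment> \<open>\<open>majorant\<close> is built from \<open>suminf\<close>, which is meaningful
    only for convergent series; bounded partial sums of nonnegative terms provide
    summability.\<close>
  have le: "(\<Sum>n<N. A n) \<le> cmod c / 4" "(\<Sum>n<N. B n) \<le> cmod c / 4" for N
    using AB'[of N] sum_nonneg[of "{..<N}" A, OF A0] sum_nonneg[of "{..<N}" B, OF B0] by linarith+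
  have sA: "summable A" by (rule summableI_nonneg_bounded[OF A0 le(1)])
  have sB: "summable B" by (rule summableI_nonneg_bounded[OF B0 le(2)])
  have "majorant a b r = (\<Sum>n. A n + B n)"
    using suminf_add[OF sA sB] by (simp add: majorant_def A_def B_def)
  also have "\<dots> \<le> cmod c / 4"
    by (rule suminf_le_const[OF summable_add[OF sA sB]]) (use AB' in \<open>simp add: sum.distrib\<close>)
  also have "\<dots> \<le> infdist 0 (frontier (\<phi> ` \<D>))"
    using koebe_quarter_infdist[OF \<Phi> \<phi> \<phi>0] by (simp add: c_def)
  finally show ?thesis .
qed

section \<open>The two equations\<close>

lemma ex1_root_of_strict_mono:
  fixes F :: "real \<Rightarrow> real"
  assumes mono: "\<And>x y. 0 \<le> x \<Longrightarrow> x < y \<Longrightarrow> y < 1 \<Longrightarrow> F x < F y"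
    and cont: "continuous_on {0..<1} F" and F0: "F 0 < y" and x: "0 < x" "x < 1" "y \<le> F x"
  shows "\<exists>!r. 0 < r \<and> r < 1 \<and> F r = y"
proof -
  have "continuous_on {0..x} F" by (rule continuous_on_subset[OF cont]) (use x in auto)
  then obtain r where r: "0 \<le> r" "r \<le> x" "F r = y"
    using IVT'[of F 0 y x] F0 x by auto
  have "r \<noteq> 0" using r F0 by auto
  show ?thesis
  proof (rule ex1I[of _ r])
    show "0 < r \<and> r < 1 \<and> F r = y" using r x \<open>r \<noteq> 0\<close> by auto
    fix s assume s: "0 < s \<and> s < 1 \<and> F s = y"
    show "s = r"
      using mono[of r s] mono[of s r] s r x by (cases r s rule: linorder_cases) auto
  qed
qed

definition rs_fun :: "real \<Rightarrow> real" where
  "rs_fun r = r / (1 - r)\<^sup>2 + r\<^sup>2 / (1 - r\<^sup>2)\<^sup>2 *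
     sqrt ((r ^ 6 + 11 * r ^ 4 + 11 * r\<^sup>2 + 1) / (1 - r\<^sup>2) * (pi\<^sup>2 / 6 - 1))"

lemma pi_square_bound: "643 / 1000 \<le> pi\<^sup>2 / 6 - 1"
proof -
  have "(3.141592653588)\<^sup>2 \<le> pi\<^sup>2" by (rule power_mono[OF pi_approx(1)]) simp
  moreover have "6 * (1643 / 1000) \<le> (3.141592653588 :: real)\<^sup>2" by (simp add: power2_eq_square)
  ultimately show ?thesis by argo
qed

lemma rs_fun_strict_mono:
  assumes "0 \<le> x" "x < y" "y < 1"
  shows "rs_fun x < rs_fun y"
proof -
  have y2: "x\<^sup>2 \<le> y\<^sup>2" "y\<^sup>2 < 1" "x\<^sup>2 \<le> 1"
    using assms by (auto intro: power_mono simp: abs_square_less_1 abs_square_le_1)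
  have "x / (1 - x)\<^sup>2 \<le> x / (1 - y)\<^sup>2"
    using assms by (intro divide_left_mono power_mono mult_pos_pos) auto
  also have "\<dots> < y / (1 - y)\<^sup>2"
    using assms by (intro divide_strict_right_mono) auto
  finally have 1: "x / (1 - x)\<^sup>2 < y / (1 - y)\<^sup>2" .
  have 2: "x\<^sup>2 / (1 - x\<^sup>2)\<^sup>2 \<le> y\<^sup>2 / (1 - y\<^sup>2)\<^sup>2"
    by (rule frac_le) (use y2 in \<open>auto intro!: power_mono\<close>)
  have 3: "(x ^ 6 + 11 * x ^ 4 + 11 * x\<^sup>2 + 1) / (1 - x\<^sup>2) * (pi\<^sup>2 / 6 - 1)
      \<le> (y ^ 6 + 11 * y ^ 4 + 11 * y\<^sup>2 + 1) / (1 - y\<^sup>2) * (pi\<^sup>2 / 6 - 1)"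
    using assms y2 pi_square_bound
    by (intro mult_right_mono frac_le add_mono mult_left_mono power_mono) auto
  have "0 \<le> (x ^ 6 + 11 * x ^ 4 + 11 * x\<^sup>2 + 1) / (1 - x\<^sup>2) * (pi\<^sup>2 / 6 - 1)"
    using assms y2 pi_square_bound by (intro mult_nonneg_nonneg divide_nonneg_nonneg) auto
  hence "x\<^sup>2 / (1 - x\<^sup>2)\<^sup>2 * sqrt ((x ^ 6 + 11 * x ^ 4 + 11 * x\<^sup>2 + 1) / (1 - x\<^sup>2) * (pi\<^sup>2 / 6 - 1))
     \<le> y\<^sup>2 / (1 - y\<^sup>2)\<^sup>2 * sqrt ((y ^ 6 + 11 * y ^ 4 + 11 * y\<^sup>2 + 1) / (1 - y\<^sup>2) * (pi\<^sup>2 / 6 - 1))"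
    by (intro mult_mono[OF 2] real_sqrt_le_mono[OF 3]) auto
  with 1 show ?thesis unfolding rs_fun_def by linarith
qed

lemma continuous_on_rs_fun: "continuous_on {0..<1} rs_fun"
proof -
  have "(1 - x\<^sup>2 :: real) \<noteq> 0" if "x \<in> {0..<1}" for x
    using that by (auto simp: power2_eq_1_iff)
  thus ?thesis unfolding rs_fun_def [abs_def] by (intro continuous_intros) auto
qed

text \<open>The point 797/5000 meets two opposing demands: it lies beyond r_s, as shown here, and is
  small enough for \<open>weighted_sum_bound\<close>. The value 919/1000 is a rational lower bound
  for the square root, based on \<open>pi_square_bound\<close>.\<close>

lemma rs_fun_upper: "1 / 4 < rs_fun (797 / 5000)"
proof -
  define \<rho> where "\<rho> = (797 / 5000 :: real)"
  define X where "X = (\<rho> ^ 6 + 11 * \<rho> ^ 4 + 11 * \<rho>\<^sup>2 + 1) / (1 - \<rho>\<^sup>2)"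
  have "(919 / 1000)\<^sup>2 \<le> X * (643 / 1000)"
    by (simp add: X_def \<rho>_def power_divide)
  also have "\<dots> \<le> X * (pi\<^sup>2 / 6 - 1)"
    by (intro mult_left_mono pi_square_bound) (simp add: X_def \<rho>_def power_divide)
  finally have "919 / 1000 \<le> sqrt (X * (pi\<^sup>2 / 6 - 1))"
    by (rule real_le_rsqrt)
  hence "\<rho> / (1 - \<rho>)\<^sup>2 + \<rho>\<^sup>2 / (1 - \<rho>\<^sup>2)\<^sup>2 * (919 / 1000) \<le> rs_fun \<rho>"
    unfolding rs_fun_def X_def by (intro add_left_mono mult_left_mono) auto
  moreover have "1 / 4 < \<rho> / (1 - \<rho>)\<^sup>2 + \<rho>\<^sup>2 / (1 - \<rho>\<^sup>2)\<^sup>2 * (919 / 1000)"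
    by (simp add: \<rho>_def power_divide)
  ultimately show ?thesis by (simp add: \<rho>_def)
qed

lemma rs_root_iff: "rs_root r \<longleftrightarrow> 0 < r \<and> r < 1 \<and> rs_fun r = 1 / 4"
  by (simp add: rs_root_def rs_fun_def)

lemma ex1_rs_root: "\<exists>!r. rs_root r"
  unfolding rs_root_iff
  by (rule ex1_root_of_strict_mono[OF rs_fun_strict_mono continuous_on_rs_fun, of _ "797 / 5000"])
    (use rs_fun_upper in \<open>simp_all add: rs_fun_def [of 0]\<close>)

lemma rs_root_le: "rs_root r \<Longrightarrow> r \<le> 797 / 5000"
  using rs_fun_strict_mono[of "797 / 5000" r] rs_fun_upper unfolding rs_root_iff by force

definition R_fun :: "real \<Rightarrow> real" where
  "R_fun R = 2 * R\<^sup>2 / (1 - R)\<^sup>2 - ln (1 - R)"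

lemma R_root_iff: "R_root R \<longleftrightarrow> 0 < R \<and> R < 1 \<and> R_fun R = 1 / 4"
  by (simp add: R_root_def R_fun_def)

lemma R_fun_strict_mono:
  assumes "0 \<le> x" "x < y" "y < 1"
  shows "R_fun x < R_fun y"
proof -
  have "2 * x\<^sup>2 / (1 - x)\<^sup>2 \<le> 2 * y\<^sup>2 / (1 - y)\<^sup>2"
    using assms by (intro frac_le mult_left_mono power_mono) auto
  moreover have "ln (1 - y) < ln (1 - x)" using assms by (subst ln_less_cancel_iff) auto
  ultimately show ?thesis by (simp add: R_fun_def)
qed

lemma continuous_on_R_fun: "continuous_on {0..<1} R_fun"
  unfolding R_fun_def [abs_def] by (intro continuous_intros) auto

text \<open>The summand for n = 0 is \<open>1 / 0 = 0\<close>, so the series effectively starts at n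
  = 1.\<close>

lemma sums_minus_ln_one_minus:
  fixes x :: real
  assumes "\<bar>x\<bar> < 1"
  shows "(\<lambda>n. x ^ n / real n) sums (- ln (1 - x))"
  using sums_minus[OF ln_series'[of "- x"]] assms by simp

lemma minus_ln_one_minus_bounds:
  fixes x :: real
  assumes x: "0 \<le> x" "x < 1"
  shows "(\<Sum>n\<le>N. x ^ n / real n) \<le> - ln (1 - x)"
    and "- ln (1 - x) \<le> (\<Sum>n\<le>N. x ^ n / real n) + x ^ Suc N / (real (Suc N) * (1 - x))"
proof -
  have s: "(\<lambda>n. x ^ n / real n) sums (- ln (1 - x))"
    using x by (intro sums_minus_ln_one_minus) auto
  show "(\<Sum>n\<le>N. x ^ n / real n) \<le> - ln (1 - x)"
    unfolding sums_unique[OF s] by (rule sum_le_suminf[OF sums_summable[OF s]]) (use x in auto)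
  have t: "(\<lambda>n. x ^ (n + Suc N) / real (n + Suc N)) sums (- ln (1 - x) - (\<Sum>n\<le>N. x ^ n / real n))"
    using sums_split_initial_segment[OF s, of "Suc N"] by (simp add: lessThan_Suc_atMost)
  have u: "(\<lambda>n. x ^ Suc N / real (Suc N) * x ^ n) sums (x ^ Suc N / real (Suc N) * (1 / (1 - x)))"
    using x by (intro sums_mult geometric_sums) auto
  have "- ln (1 - x) - (\<Sum>n\<le>N. x ^ n / real n) \<le> x ^ Suc N / real (Suc N) * (1 / (1 - x))"
  proof (rule sums_le[OF _ t u])
    fix n
    have "x ^ (n + Suc N) / real (n + Suc N) \<le> x ^ (n + Suc N) / real (Suc N)"
      using x by (intro divide_left_mono) auto
    thus "x ^ (n + Suc N) / real (n + Suc N) \<le> x ^ Suc N / real (Suc N) * x ^ n"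
      by (simp add: power_add mult_ac)
  qed
  thus "- ln (1 - x) \<le> (\<Sum>n\<le>N. x ^ n / real n) + x ^ Suc N / (real (Suc N) * (1 - x))"
    by simp
qed

text \<open>Between the two points \<open>R_fun\<close> grows by about 2.3e-6, while the remainder
  bound of the logarithm series after degree 6 is below 5e-7.\<close>

lemma R_fun_bounds: "R_fun 0.161353 \<le> 1 / 4" "1 / 4 < R_fun 0.161354"
proof -
  show "R_fun 0.161353 \<le> 1 / 4"
    using minus_ln_one_minus_bounds(2)[of "0.161353" 6]
    by (simp add: R_fun_def eval_nat_numeral power_divide field_simps)
  show "1 / 4 < R_fun 0.161354"
    using minus_ln_one_minus_bounds(1)[of "0.161354" 6]
    by (simp add: R_fun_def eval_nat_numeral power_divide field_simps)
qed

lemma ex1_R_root: "\<exists>!R. R_root R"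
  unfolding R_root_iff
  by (rule ex1_root_of_strict_mono[OF R_fun_strict_mono continuous_on_R_fun, of _ "0.161354"])
    (use R_fun_bounds(2) in \<open>simp_all add: R_fun_def [of 0]\<close>)

lemma R_root_bounds:
  assumes "R_root R"
  shows "0.161353 \<le> R" "R < 0.161354"
proof -
  have R: "0 < R" "R < 1" "R_fun R = 1 / 4" using assms by (auto simp: R_root_iff)
  show "0.161353 \<le> R"
  proof (rule ccontr)
    assume "\<not> 0.161353 \<le> R"
    hence "R_fun R < R_fun 0.161353" using R by (intro R_fun_strict_mono) auto
    thus False using R R_fun_bounds(1) by linarith
  qed
  show "R < 0.161354"
  proof (rule ccontr)
    assume "\<not> R < 0.161354"
    hence "R = 0.161354 \<or> 0.161354 < R" by linarith
    hence "R_fun 0.161354 \<le> R_fun R"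
    proof
      assume "0.161354 < R"
      hence "R_fun 0.161354 < R_fun R" using R by (intro R_fun_strict_mono) auto
      thus ?thesis by simp
    qed (simp only: order_refl)
    thus False using R R_fun_bounds(2) by linarith
  qed
qed

section \<open>The extremal example\<close>

text \<open>The Cauchy-Riemann equations supply the witnesses: real and negated imaginary parts of
  F' and F'', with u22 = - Re F''.\<close>

lemma harmonic_on_Re_holomorphic:
  assumes F: "F holomorphic_on S" and S: "open S"
  shows "harmonic_on (\<lambda>z. Re (F z)) S"
proof -
  define F1 where "F1 = deriv F"
  define F2 where "F2 = deriv F1"
  have h1: "F1 holomorphic_on S" unfolding F1_def by (rule holomorphic_deriv[OF F S])
  have h2: "F2 holomorphic_on S" unfolding F2_def by (rule holomorphic_deriv[OF h1 S])
  have d: "(F has_derivative (\<lambda>v. F1 z * v)) (at z)" "(F1 has_derivative (\<lambda>v. F2 z * v)) (at z)" if "z \<in> S" for z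
    using holomorphic_derivI[OF F S that] holomorphic_derivI[OF h1 S that]
    by (simp_all add: has_field_derivative_def F1_def F2_def)
  have c2: "continuous_on S F2" by (rule holomorphic_on_imp_continuous_on[OF h2])
  show ?thesis
    unfolding harmonic_on_def
  proof (intro conjI S exI ballI)
    fix z assume z: "z \<in> S"
    show "((\<lambda>z. Re (F z)) has_derivative (\<lambda>v. Re (F1 z) * Re v + (- Im (F1 z)) * Im v)) (at z)"
      using has_derivative_Re[OF d(1)[OF z]] by simp
    show "((\<lambda>z. Re (F1 z)) has_derivative (\<lambda>v. Re (F2 z) * Re v + (- Im (F2 z)) * Im v)) (at z)"
      using has_derivative_Re[OF d(2)[OF z]] by simp
    show "((\<lambda>z. - Im (F1 z)) has_derivative (\<lambda>v. (- Im (F2 z)) * Re v + (- Re (F2 z)) * Im v)) (at z)"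
      using has_derivative_minus[OF has_derivative_Im[OF d(2)[OF z]]] by (simp add: algebra_simps)
    show "Re (F2 z) + - Re (F2 z) = 0" by simp
  qed (intro continuous_intros c2)+
qed

lemma harmonic_mapping_on_holomorphic_plus_cnj:
  assumes h: "h holomorphic_on S" and g: "g holomorphic_on S" and S: "open S"
  shows "harmonic_mapping_on (\<lambda>z. h z + cnj (g z)) S"
proof -
  have "harmonic_on (\<lambda>z. Re (h z + g z)) S"
    by (intro harmonic_on_Re_holomorphic holomorphic_intros h g S)
  \<comment> \<open>The imaginary part of h + cnj g is Im (h - g), which is the real part of - i (h
    - g).\<close>
  moreover have "harmonic_on (\<lambda>z. Re (- \<i> * (h z - g z))) S"
    by (intro harmonic_on_Re_holomorphic holomorphic_intros h g S)
  ultimately show ?thesis by (simp add: harmonic_mapping_on_def)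
qed

text \<open>Near z0 both h and g are linear up to an error \<epsilon> |z - w|. With \<epsilon> a
  third of the gap |h'| - |g'| at z0, a gap of \<epsilon> survives both errors, so increments of h
  and g of equal modulus force z = w.\<close>

lemma locally_univalent_on_holomorphic_plus_cnj:
  assumes h: "h holomorphic_on S" and g: "g holomorphic_on S" and S: "open S"
    and dil: "\<And>z. z \<in> S \<Longrightarrow> cmod (deriv g z) < cmod (deriv h z)"
  shows "locally_univalent_on (\<lambda>z. h z + cnj (g z)) S"
  unfolding locally_univalent_on_def
proof
  fix z0 assume z0: "z0 \<in> S"
  define \<epsilon> where "\<epsilon> = (cmod (deriv h z0) - cmod (deriv g z0)) / 3"
  have \<epsilon>: "\<epsilon> > 0" using dil[OF z0] by (simp add: \<epsilon>_def)
  have near: "\<exists>d>0. ball z0 d \<subseteq> S \<and> (\<forall>z\<in>ball z0 d. \<forall>w\<in>ball z0 d.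
      cmod ((F z - F w) - deriv F z0 * (z - w)) \<le> \<epsilon> * cmod (z - w))" if F: "F holomorphic_on S" for F
  proof -
    have "continuous_on S (deriv F)"
      by (rule holomorphic_on_imp_continuous_on[OF holomorphic_deriv[OF F S]])
    hence "continuous (at z0) (deriv F)" using S z0 continuous_on_eq_continuous_at by blast
    then obtain d1 where d1: "d1 > 0" "\<And>z. dist z z0 < d1 \<Longrightarrow> dist (deriv F z) (deriv F z0) < \<epsilon>"
      using \<epsilon> unfolding continuous_at_eps_delta by blast
    obtain d2 where d2: "d2 > 0" "ball z0 d2 \<subseteq> S" using S z0 openE by blast
    define d where "d = min d1 d2"
    have sub: "ball z0 d \<subseteq> S" using d2 by (auto simp: d_def)
    have "cmod ((F z - F w) - deriv F z0 * (z - w)) \<le> \<epsilon> * cmod (z - w)" if zw: "z \<in> ball z0 d" "w \<in> ball z0 d" for z w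
    proof -
      have "cmod ((F z - deriv F z0 * z) - (F w - deriv F z0 * w)) \<le> \<epsilon> * cmod (z - w)"
      proof (rule field_differentiable_bound[of "ball z0 d" _ "\<lambda>x. deriv F x - deriv F z0"])
        fix x assume x: "x \<in> ball z0 d"
        have "(F has_field_derivative deriv F x) (at x)"
          using holomorphic_derivI[OF F S] x sub by blast
        thus "((\<lambda>x. F x - deriv F z0 * x) has_field_derivative deriv F x - deriv F z0) (at x within ball z0 d)"
          by (auto intro!: derivative_eq_intros intro: has_field_derivative_at_within)
        show "cmod (deriv F x - deriv F z0) \<le> \<epsilon>"
          using d1(2)[of x] x by (simp add: d_def dist_norm norm_minus_commute)
      qed (use zw in auto)
      thus ?thesis by (simp add: algebra_simps)
    qed
    thus ?thesis using d1 d2 sub by (intro exI[of _ d]) (auto simp: d_def)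
  qed
  obtain dh where dh: "dh > 0" "ball z0 dh \<subseteq> S" "\<And>z w. z \<in> ball z0 dh \<Longrightarrow> w \<in> ball z0 dh \<Longrightarrow>
      cmod ((h z - h w) - deriv h z0 * (z - w)) \<le> \<epsilon> * cmod (z - w)" using near[OF h] by blast
  obtain dg where dg: "dg > 0" "ball z0 dg \<subseteq> S" "\<And>z w. z \<in> ball z0 dg \<Longrightarrow> w \<in> ball z0 dg \<Longrightarrow>
      cmod ((g z - g w) - deriv g z0 * (z - w)) \<le> \<epsilon> * cmod (z - w)" using near[OF g] by blast
  have "inj_on (\<lambda>z. h z + cnj (g z)) (ball z0 (min dh dg))"
  proof (rule inj_onI)
    fix z w assume zw: "z \<in> ball z0 (min dh dg)" "w \<in> ball z0 (min dh dg)" "h z + cnj (g z) = h w + cnj (g w)"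
    have "h z - h w = - cnj (g z - g w)" using zw(3) by (simp add: algebra_simps)
    hence eq: "cmod (h z - h w) = cmod (g z - g w)" by (simp only: norm_minus_cancel complex_mod_cnj)
    have "cmod (deriv h z0) * cmod (z - w) \<le> cmod (h z - h w) + \<epsilon> * cmod (z - w)"
      using dh(3)[of z w] zw norm_triangle_ineq2[of "deriv h z0 * (z - w)" "h z - h w"]
      by (simp add: norm_mult norm_minus_commute)
    moreover have "cmod (g z - g w) \<le> cmod (deriv g z0) * cmod (z - w) + \<epsilon> * cmod (z - w)"
      using dg(3)[of z w] zw norm_triangle_ineq2[of "g z - g w" "deriv g z0 * (z - w)"]
      by (simp add: norm_mult)
    ultimately have "(cmod (deriv h z0) - cmod (deriv g z0) - 2 * \<epsilon>) * cmod (z - w) \<le> 0"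
      using eq by (simp add: algebra_simps)
    moreover have "cmod (deriv h z0) - cmod (deriv g z0) - 2 * \<epsilon> = \<epsilon>" by (simp add: \<epsilon>_def field_simps)
    ultimately have "\<epsilon> * cmod (z - w) \<le> 0" by simp
    thus "z = w" using \<epsilon> by (simp add: mult_le_0_iff)
  qed
  moreover have "ball z0 (min dh dg) \<subseteq> S" using dh(2) by auto
  ultimately show "\<exists>U. open U \<and> z0 \<in> U \<and> U \<subseteq> S \<and> inj_on (\<lambda>z. h z + cnj (g z)) U"
    using dh(1) dg(1) by (intro exI[of _ "ball z0 (min dh dg)"]) auto
qed

definition koebe :: "complex \<Rightarrow> complex" where
  "koebe z = z / (1 - z)\<^sup>2"

lemma koebe_holomorphic: "koebe holomorphic_on \<D>"
  unfolding koebe_def [abs_def] by (intro holomorphic_intros) auto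

lemma koebe_has_field_derivative:
  assumes "z \<noteq> 1"
  shows "(koebe has_field_derivative (1 + z) / (1 - z) ^ 3) (at z)"
proof -
  define u where "u = 1 - z"
  have u: "z = 1 - u" "u \<noteq> 0" using assms by (auto simp: u_def)
  have "((\<lambda>z. (1 - z)\<^sup>2) has_field_derivative - 2 * (1 - z)) (at z)"
    by (auto intro!: derivative_eq_intros)
  from DERIV_quotient[OF DERIV_ident this]
  have "(koebe has_field_derivative (1 * (1 - z)\<^sup>2 - - 2 * (1 - z) * z) / ((1 - z)\<^sup>2)\<^sup>2) (at z)"
    using assms by (simp add: koebe_def [abs_def] numeral_2_eq_2)
  also have "(1 * (1 - z)\<^sup>2 - - 2 * (1 - z) * z) / ((1 - z)\<^sup>2)\<^sup>2 = (1 + z) / (1 - z) ^ 3"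
    unfolding u(1) using u(2) by (simp add: field_simps power2_eq_square power3_eq_cube)
  finally show ?thesis .
qed

lemma koebe_deriv: "z \<in> \<D> \<Longrightarrow> deriv koebe z = (1 + z) / (1 - z) ^ 3"
  by (rule DERIV_imp_deriv, rule koebe_has_field_derivative) auto

lemma koebe_inj: "inj_on koebe \<D>"
proof (rule inj_onI)
  fix z w assume zw: "z \<in> \<D>" "w \<in> \<D>" "koebe z = koebe w"
  have "1 - z \<noteq> 0" "1 - w \<noteq> 0" using zw by auto
  hence "z * (1 - w)\<^sup>2 = w * (1 - z)\<^sup>2"
    using zw(3) by (simp add: koebe_def frac_eq_eq)
  hence "(z - w) * (1 - z * w) = 0"
    by (simp add: algebra_simps power2_eq_square)
  moreover have "cmod (z * w) < 1" using norm_mult_less[of z 1 w 1] zw by simp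
  hence "1 - z * w \<noteq> 0" by auto
  ultimately show "z = w" by simp
qed

text \<open>The value -1/4 would require (1 + z)^2 = 0, so it is omitted, but it is the limit along
  the negative radius.\<close>

lemma koebe_infdist_le: "infdist 0 (frontier (koebe ` \<D>)) \<le> 1 / 4"
proof -
  have "- 1 / 4 \<notin> koebe ` \<D>"
  proof
    assume "- 1 / 4 \<in> koebe ` \<D>"
    then obtain z where z: "z \<in> \<D>" "koebe z = - 1 / 4" by force
    have "1 - z \<noteq> 0" using z by auto
    hence "z = - 1 / 4 * (1 - z)\<^sup>2" using z(2) by (simp add: koebe_def divide_eq_eq)
    hence "4 * z = 4 * (- 1 / 4 * (1 - z)\<^sup>2)" by (rule arg_cong)
    moreover have "(1 + z)\<^sup>2 = (1 - z)\<^sup>2 + 4 * z" by (simp add: power2_eq_square algebra_simps)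
    ultimately have "(1 + z)\<^sup>2 = 0" by simp
    hence "z = - 1" by (simp add: add_eq_0_iff)
    thus False using z(1) by simp
  qed
  hence "- 1 / 4 \<notin> interior (koebe ` \<D>)" using interior_subset by blast
  moreover have "- 1 / 4 \<in> closure (koebe ` \<D>)"
    unfolding closure_sequential
  proof (intro exI conjI allI)
    define x where "x = (\<lambda>n. - of_real (real n / real (Suc n)) :: complex)"
    have "x \<longlonglongrightarrow> - of_real 1"
      unfolding x_def by (intro tendsto_intros LIMSEQ_n_over_Suc_n)
    hence "(\<lambda>n. koebe (x n)) \<longlonglongrightarrow> (- of_real 1) / (1 - (- of_real 1))\<^sup>2"
      unfolding koebe_def by (intro tendsto_intros) auto
    thus "(\<lambda>n. koebe (x n)) \<longlonglongrightarrow> - 1 / 4" by simp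
    show "koebe (x n) \<in> koebe ` \<D>" for n
      by (rule imageI) (simp add: x_def norm_divide del: of_nat_Suc)
  qed
  ultimately have "- 1 / 4 \<in> frontier (koebe ` \<D>)" by (simp add: frontier_def)
  hence "infdist 0 (frontier (koebe ` \<D>)) \<le> dist 0 (- 1 / 4 :: complex)" by (rule infdist_le)
  thus ?thesis by (simp add: norm_divide)
qed

lemma koebe_series:
  fixes z :: "'a :: {real_normed_field, banach}"
  assumes "norm z < 1"
  shows "(\<lambda>n. of_nat (n + 1) * z ^ (n + 1)) sums (z / (1 - z)\<^sup>2)"
  using sums_mult[OF geometric_deriv_sums[OF assms], of z] by (simp add: mult_ac)

text \<open>The coefficients come from \<open>n b\<^sub>n = (n - 1)\<^sup>2\<close>, that is \<open>g' = z k'\<close> with the Koebe function \<open>k\<close>; the closed form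
  uses \<open>b\<^sub>n = n - 2 + 1 / n\<close>.\<close>

lemma koebe_dilatation_series:
  fixes z :: "'a :: {real_normed_field, banach}"
  assumes z: "norm z < 1" and L: "(\<lambda>n. z ^ n / of_nat n) sums L"
  shows "(\<lambda>n. of_nat ((n + 1)\<^sup>2) / of_nat (n + 2) * z ^ (n + 2)) sums (z / (1 - z)\<^sup>2 - 2 * (z / (1 - z)) + L)"
proof -
  have L': "(\<lambda>n. z ^ (n + 1) / of_nat (n + 1)) sums L"
    using L sums_Suc_iff[of "\<lambda>n. z ^ n / of_nat n" L] by simp
  have 1: "(\<lambda>n. of_nat (n + 1) * z ^ (n + 1) - 2 * (z * z ^ n) + z ^ (n + 1) / of_nat (n + 1)) sums
     (z / (1 - z)\<^sup>2 - 2 * (z * (1 / (1 - z))) + L)"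
    by (intro sums_add sums_diff sums_mult koebe_series z geometric_sums L')
  have eq: "of_nat (n + 2) * z ^ (n + 2) - 2 * (z * z ^ (n + 1)) + z ^ (n + 2) / of_nat (n + 2)
     = of_nat ((n + 1)\<^sup>2) / of_nat (n + 2) * z ^ (n + 2)" for n
  proof -
    have "(of_nat (n + 2) :: 'a) \<noteq> 0" by (simp only: of_nat_eq_0_iff)
    thus ?thesis by (simp add: field_simps power2_eq_square)
  qed
  have "(\<lambda>n. of_nat (Suc n + 1) * z ^ (Suc n + 1) - 2 * (z * z ^ Suc n) + z ^ (Suc n + 1) / of_nat (Suc n + 1)) sums
     (z / (1 - z)\<^sup>2 - 2 * (z * (1 / (1 - z))) + L)"
    using 1 by (subst sums_Suc_iff) simp
  thus ?thesis using eq by (simp add: add.commute)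
qed

lemma koebe_example_admissible:
  "\<exists>f g. admissible f koebe g of_nat (\<lambda>n. of_nat ((n - 1)\<^sup>2) / of_nat n) koebe"
proof -
  define g where "g = (\<lambda>z. koebe z - 2 * (z / (1 - z)) - Ln (1 - z))"
  have nn: "1 - z \<notin> \<real>\<^sub>\<le>\<^sub>0" if "z \<in> \<D>" for z
  proof
    assume "1 - z \<in> \<real>\<^sub>\<le>\<^sub>0"
    hence "Re z \<ge> 1" by (auto simp: complex_nonpos_Reals_iff)
    thus False using that complex_Re_le_cmod[of z] by simp
  qed
  have hg: "g holomorphic_on \<D>"
    unfolding g_def by (intro holomorphic_intros koebe_holomorphic nn) auto
  have dg: "deriv g z = z * deriv koebe z" if z: "z \<in> \<D>" for z
  proof -
    define u where "u = 1 - z"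
    have u: "z = 1 - u" "u \<noteq> 0" using z by (auto simp: u_def)
    have "((\<lambda>z. z / (1 - z)) has_field_derivative (1 * (1 - z) - - 1 * z) / (1 - z)\<^sup>2) (at z)"
      using DERIV_quotient[of "\<lambda>z. z" 1 z UNIV "\<lambda>z. 1 - z" "- 1"] u
      by (auto intro!: derivative_eq_intros simp: numeral_2_eq_2)
    moreover have "((\<lambda>z. Ln (1 - z)) has_field_derivative - 1 / (1 - z)) (at z)"
      using nn[OF z] by (auto intro!: derivative_eq_intros simp: divide_inverse)
    moreover have "(koebe has_field_derivative (1 + z) / (1 - z) ^ 3) (at z)"
      using u by (intro koebe_has_field_derivative) auto
    ultimately have "(g has_field_derivative (1 + z) / (1 - z) ^ 3 - 2 * ((1 * (1 - z) - - 1 * z) / (1 - z)\<^sup>2) - - 1 / (1 - z)) (at z)"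
      unfolding g_def by (intro DERIV_diff DERIV_cmult)
    also have "(1 + z) / (1 - z) ^ 3 - 2 * ((1 * (1 - z) - - 1 * z) / (1 - z)\<^sup>2) - - 1 / (1 - z) = z * ((1 + z) / (1 - z) ^ 3)"
      unfolding u(1) using u(2) by (simp add: field_simps power2_eq_square power3_eq_cube)
    finally have "(g has_field_derivative z * ((1 + z) / (1 - z) ^ 3)) (at z)" .
    thus ?thesis unfolding koebe_deriv[OF z] by (rule DERIV_imp_deriv)
  qed
  have dil: "cmod (deriv g z) < cmod (deriv koebe z)" if z: "z \<in> \<D>" for z
  proof -
    have "1 + z \<noteq> 0" using z by (auto simp: add_eq_0_iff)
    moreover have "1 - z \<noteq> 0" using z by auto
    ultimately have "deriv koebe z \<noteq> 0" by (simp add: koebe_deriv[OF z])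
    thus ?thesis using z by (simp add: dg[OF z] norm_mult)
  qed
  have "sense_preserving_harmonic (\<lambda>z. koebe z + cnj (g z)) koebe g"
    unfolding sense_preserving_harmonic_def
    by (intro conjI harmonic_mapping_on_holomorphic_plus_cnj locally_univalent_on_holomorphic_plus_cnj
          koebe_holomorphic hg open_ball dil ballI refl)
      (use dil in \<open>auto simp: g_def koebe_def intro!: power_strict_mono\<close>)
  moreover have "(\<lambda>n. of_nat (n + 1) * z ^ (n + 1)) sums koebe z" if "z \<in> \<D>" for z
    using koebe_series[of z] that by (simp add: koebe_def)
  moreover have "(\<lambda>n. of_nat ((n + 2 - 1)\<^sup>2) / of_nat (n + 2) * z ^ (n + 2)) sums g z" if "z \<in> \<D>" for z
  proof -
    have "(\<lambda>n. z ^ n / of_nat n) sums (- Ln (1 - z))"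
      using sums_minus[OF Ln_series'[of "- z"]] that by simp
    from koebe_dilatation_series[OF _ this] show ?thesis using that by (simp add: g_def koebe_def)
  qed
  moreover have "subordinate koebe koebe"
    unfolding subordinate_def using koebe_holomorphic by (auto intro!: exI[of _ "\<lambda>z. z"])
  ultimately show ?thesis
    unfolding admissible_def using koebe_holomorphic koebe_inj by blast
qed

text \<open>The origin of the equation for R: it says that this majorant equals 1/4, a bound for the
  distance of 0 from the frontier of the Koebe image.\<close>

lemma koebe_example_majorant:
  assumes "0 \<le> r" "r < 1"
  shows "majorant of_nat (\<lambda>n. of_nat ((n - 1)\<^sup>2) / of_nat n) r = 2 * r\<^sup>2 / (1 - r)\<^sup>2 - ln (1 - r)"
proof -
  have "(\<lambda>n. r ^ n / real n) sums (- ln (1 - r))"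
    using assms by (intro sums_minus_ln_one_minus) auto
  from koebe_dilatation_series[OF _ this]
  have "(\<lambda>n. real ((n + 1)\<^sup>2) / real (n + 2) * r ^ (n + 2)) sums (r / (1 - r)\<^sup>2 - 2 * (r / (1 - r)) - ln (1 - r))"
    using assms by simp
  moreover have "(\<lambda>n. real (n + 1) * r ^ (n + 1)) sums (r / (1 - r)\<^sup>2)"
    using koebe_series[of r] assms by simp
  ultimately have "majorant of_nat (\<lambda>n. of_nat ((n - 1)\<^sup>2) / of_nat n) r
      = r / (1 - r)\<^sup>2 + (r / (1 - r)\<^sup>2 - 2 * (r / (1 - r)) - ln (1 - r))"
    unfolding majorant_def norm_divide norm_of_nat by (simp add: sums_iff)
  also have "\<dots> = 2 * r\<^sup>2 / (1 - r)\<^sup>2 - ln (1 - r)"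
  proof -
    define u where "u = 1 - r"
    have u: "r = 1 - u" "u \<noteq> 0" using assms by (auto simp: u_def)
    show ?thesis unfolding u(1) using u(2) by (simp add: field_simps power2_eq_square)
  qed
  finally show ?thesis .
qed

theorem corollary5:
  shows "(\<exists>!r\<^sub>s. rs_root r\<^sub>s) \<and>
    (\<forall>r\<^sub>s. rs_root r\<^sub>s \<longrightarrow>
      (\<forall>f h g a b \<phi>. admissible f h g a b \<phi> \<longrightarrow>
        (\<forall>r. 0 \<le> r \<and> r \<le> r\<^sub>s \<longrightarrow> majorant a b r \<le> infdist 0 (frontier (\<phi> ` \<D>))))) \<and>
    (\<exists>!R. R_root R) \<and>
    (\<forall>R. R_root R \<longrightarrow> 
      0.161353 \<le> R \<and> R < 0.161354 \<and>
      (\<forall>\<rho>. R < \<rho> \<and> \<rho> < 1 \<longrightarrow>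
        (\<exists>f h g a b \<phi>. admissible f h g a b \<phi> \<and>
          (\<exists>r. 0 \<le> r \<and> r \<le> \<rho> \<and> \<not> majorant a b r \<le> infdist 0 (frontier (\<phi> ` \<D>))))))"
proof (intro conjI allI impI)
  show "\<exists>!r\<^sub>s. rs_root r\<^sub>s" by (rule ex1_rs_root)
  show "\<exists>!R. R_root R" by (rule ex1_R_root)
next
  fix r\<^sub>s f h g a b \<phi> and r :: real
  assume "rs_root r\<^sub>s" "admissible f h g a b \<phi>" "0 \<le> r \<and> r \<le> r\<^sub>s"
  thus "majorant a b r \<le> infdist 0 (frontier (\<phi> ` \<D>))"
    using majorant_le_infdist rs_root_le by force
next
  fix R assume "R_root R"
  thus "0.161353 \<le> R" "R < 0.161354" by (rule R_root_bounds)+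
next
  fix R \<rho> assume R: "R_root R" and \<rho>: "R < \<rho> \<and> \<rho> < 1"
  \<comment> \<open>The radius at which the inequality fails is \<rho> itself.\<close>
  have "1 / 4 < R_fun \<rho>"
    using R \<rho> R_fun_strict_mono[of R \<rho>] by (simp add: R_root_iff)
  hence "\<not> majorant of_nat (\<lambda>n. of_nat ((n - 1)\<^sup>2) / of_nat n) \<rho> \<le> infdist 0 (frontier (koebe ` \<D>))"
    using koebe_infdist_le koebe_example_majorant[of \<rho>] R \<rho> by (simp add: R_fun_def R_root_iff)
  moreover have "0 \<le> \<rho>" using R \<rho> by (simp add: R_root_iff)
  ultimately show "\<exists>f h g a b \<phi>. admissible f h g a b \<phi> \<and>
      (\<exists>r. 0 \<le> r \<and> r \<le> \<rho> \<and> \<not> majorant a b r \<le> infdist 0 (frontier (\<phi> ` \<D>)))"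
    using koebe_example_admissible by blast
qed

end
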